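(* For every graph $G=(V,E)$ with $m$ edges and $n=|V|$ vertices, there exists a sequence of vertex sets $V=S_0\supsetneq S_1\supsetneq\cdots\supsetneq S_n=\emptyset$ such that $\max_{i\in[n]}|E[S_i,V\setminus S_i]|\le m/2+7m^{4/5}$. Furthermore, such a sequence can be computed in randomized polynomial time.
   Context: For disjoint $S_1,S_2\subseteq V$, $E[S_1,S_2]$ denotes the set of edges with one endpoint in $S_1$ and the other in $S_2$. *)

theory Defs
  imports "HOL-Probability.Probability" "HOL-Computational_Algebra.Polynomial"
begin

section \<open>Graphs and chains of vertex sets\<close>

definition fin_simple_graph :: "'a set \<Rightarrow> 'a set set \<Rightarrow> bool" where
  "fin_simple_graph V E \<longleftrightarrow> finite V \<and> (\<forall>e\<in>E. e \<subseteq> V \<and> card e = 2)"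

definition edges_between :: "'a set set \<Rightarrow> 'a set \<Rightarrow> 'a set \<Rightarrow> 'a set set" where
  "edges_between E S T = {e \<in> E. \<exists>u\<in>S. \<exists>v\<in>T. e = {u, v}}"

(* Only S 0, ..., S (card V) matter. The maximum over i in [n] is written as a bound
   for each i, which also covers n = 0, where the maximum would range over nothing. *)
definition low_cut_chain :: "'a set \<Rightarrow> 'a set set \<Rightarrow> (nat \<Rightarrow> 'a set) \<Rightarrow> bool" where
  "low_cut_chain V E S \<longleftrightarrow>
     S 0 = V \<and> S (card V) = {} \<and> (\<forall>i<card V. S (Suc i) \<subset> S i) \<and>
     (\<forall>i\<in>{1..card V}. real (card (edges_between E (S i) (V - S i)))
        \<le> real (card E) / 2 + 7 * real (card E) powr (4 / 5))"


section \<open>Randomized polynomial time\<close>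

(* The model is a random access machine with coin flips, presented as a while language.
   A program names finitely many arrays of natural numbers; a scalar variable is cell 0
   of an array. Arithmetic is addition and truncated subtraction only, and every step
   costs one time unit. As there is no multiplication and the expressions of a program
   have fixed size, T steps only produce numbers of bit length O(T + input length), so
   polynomial time here is polynomial time on a probabilistic Turing machine. *)

type_synonym state = "string \<Rightarrow> nat \<Rightarrow> nat"

datatype aexp =
    Const nat
  | Cell string aexp
  | Plus aexp aexp
  | Minus aexp aexp

primrec aval :: "aexp \<Rightarrow> state \<Rightarrow> nat" where
  "aval (Const k) s = k"
| "aval (Cell x a) s = s x (aval a s)"
| "aval (Plus a b) s = aval a s + aval b s"
| "aval (Minus a b) s = aval a s - aval b s"

datatype com =
    Skip
  | Assign string aexp aexp
  | Flip string aexp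
  | Seq com com
  | If aexp com com
  | While aexp com

definition update :: "state \<Rightarrow> string \<Rightarrow> nat \<Rightarrow> nat \<Rightarrow> state" where
  "update s x i k = s(x := (s x)(i := k))"

(* Assign x a b is x[a] := b, and Flip x a stores a fair random bit in x[a].
   Tests are true when nonzero. A computation has halted when it has reached Skip. *)
primrec step :: "com \<Rightarrow> state \<Rightarrow> (com \<times> state) pmf" where
  "step Skip s = return_pmf (Skip, s)"
| "step (Assign x a b) s = return_pmf (Skip, update s x (aval a s) (aval b s))"
| "step (Flip x a) s =
     map_pmf (\<lambda>b. (Skip, update s x (aval a s) (of_bool b))) (bernoulli_pmf (1 / 2))"
| "step (Seq c d) s =
     (if c = Skip then return_pmf (d, s)
      else map_pmf (\<lambda>(c', s'). (Seq c' d, s')) (step c s))"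
| "step (If a c d) s = return_pmf (if aval a s \<noteq> 0 then c else d, s)"
| "step (While a c) s = return_pmf (If a (Seq c (While a c)) Skip, s)"

primrec run :: "nat \<Rightarrow> com \<Rightarrow> state \<Rightarrow> (com \<times> state) pmf" where
  "run 0 c s = return_pmf (c, s)"
| "run (Suc t) c s = bind_pmf (step c s) (\<lambda>(c', s'). run t c' s')"

(* A search problem: sol x s says that the final memory s holds a solution of the
   instance x. One program must serve all instances; it halts within polynomial time
   for every outcome of its coin flips, and its answer is correct with probability at
   least 2/3. *)
definition rand_poly_time_solvable ::
  "'i set \<Rightarrow> ('i \<Rightarrow> nat) \<Rightarrow> ('i \<Rightarrow> state) \<Rightarrow> ('i \<Rightarrow> state \<Rightarrow> bool) \<Rightarrow> bool" where
  "rand_poly_time_solvable Inst size_of enc sol \<longleftrightarrow>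
     (\<exists>(c :: com) (p :: nat poly). \<forall>x\<in>Inst.
        (\<forall>(c', s')\<in>set_pmf (run (poly p (size_of x)) c (enc x)). c' = Skip) \<and>
        measure_pmf.prob (run (poly p (size_of x)) c (enc x))
          {(c', s'). c' = Skip \<and> sol x s'} \<ge> 2 / 3)"

(* A graph on {..<n} is given by n and its adjacency matrix, row by row; all other
   memory is 0. *)
definition graph_input :: "nat \<Rightarrow> nat set set \<Rightarrow> state" where
  "graph_input n E = (\<lambda>x k.
     if x = ''n'' \<and> k = 0 then n
     else if x = ''adj'' \<and> k < n * n \<and> {k div n, k mod n} \<in> E then 1
     else 0)"

(* The sets S_0, ..., S_n are returned as indicator vectors, one after the other. *)
definition output_sets :: "nat \<Rightarrow> state \<Rightarrow> nat \<Rightarrow> nat set" where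
  "output_sets n s i = {v. v < n \<and> s ''out'' (i * n + v) \<noteq> 0}"

end

theory Submission
  imports Defs
begin

text \<open>
  Order the vertices by decreasing degree and send each of them to the left or to the right by a
  fair coin. The final ordering is the left vertices from the lowest to the highest degree,
  followed by the right vertices from the highest to the lowest degree. Every cut of this ordering
  is, up to complement, the cut of the left (or of the right) vertices among the outermost ones,
  so its expectation is at most \<open>m / 2\<close>. Revealing the coins from high to low degree
  changes twice the cut minus the number of edges seen so far by at most the number \<open>b w\<close>
  of neighbours of \<open>w\<close> seen before. Because of the degree ordering \<open>(b w)\<^sup>2 \<le> 2 m\<close>,
  and the \<open>b w\<close> sum to \<open>m\<close>, so the variance proxy is \<open>O(m powr (3/2))\<close>. An exponential
  moment bound and a union bound over at most \<open>4 m\<close> cuts then give deviation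
  \<open>7 m powr (4/5)\<close> with a failure probability below \<open>1/3\<close>.

  The program ranks the vertices by a number \<open>C - K v\<close> (left) or \<open>C + K v\<close> (right), where
  \<open>K v = v + n * (number of non-neighbours of v)\<close> orders by decreasing degree without ties.
\<close>

section \<open>Concentration of the cuts\<close>

text \<open>Hoeffding's lemma for two values at distance \<open>2 * \<bar>x\<bar>\<close> with
  probability 1/2 each, with the common factor \<open>exp \<bar>x\<bar>\<close> cancelled.\<close>

lemma cosh_le_exp_half_square:
  fixes x :: real
  shows "cosh x \<le> exp (x\<^sup>2 / 2)"
proof -
  define h where "h = 2 * \<bar>x\<bar>"
  have "- h * (1/2) + ln (1 + (1/2) * (exp h - 1)) \<le> h\<^sup>2 / 8"
    by (rule Hoeffdings_lemma_aux) (simp_all add: h_def)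
  hence "ln ((1 + exp h) / 2) \<le> h / 2 + h\<^sup>2 / 8"
    by (simp add: field_simps)
  hence "(1 + exp h) / 2 \<le> exp (h / 2 + h\<^sup>2 / 8)"
    by (simp add: ln_le_cancel_iff add_pos_pos flip: exp_le_cancel_iff [of "ln _"])
  also have "\<dots> = exp \<bar>x\<bar> * exp (x\<^sup>2 / 2)"
    by (simp add: h_def exp_add)
  also have "(1 + exp h) / 2 = exp \<bar>x\<bar> * cosh \<bar>x\<bar>"
    by (simp add: cosh_field_def h_def field_simps flip: exp_add)
  finally show ?thesis by simp
qed

lemma exp_shift_sum:
  fixes l x d :: real
  shows "exp (l * (x + d)) + exp (l * (x - d)) = exp (l * x) * (2 * cosh (l * d))"
proof -
  have "2 * cosh (l * d) = exp (l * d) + exp (- (l * d))"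
    by (simp add: cosh_field_def)
  then show ?thesis
    by (simp add: distrib_left right_diff_distrib mult_exp_exp)
qed

text \<open>Expectations over independent fair coins appear as sums over all subsets; this splits
  off the coin of \<open>a\<close>.\<close>

lemma sum_Pow_insert:
  assumes "finite A" "a \<notin> A"
  shows "(\<Sum>X\<in>Pow (insert a A). f X) = (\<Sum>X\<in>Pow A. f X + f (insert a X))"
proof -
  have "(\<Sum>X\<in>Pow (insert a A). f X) = (\<Sum>X\<in>Pow A. f X) + (\<Sum>X\<in>insert a ` Pow A. f X)"
    unfolding Pow_insert using assms by (intro sum.union_disjoint) auto
  also have "(\<Sum>X\<in>insert a ` Pow A. f X) = (\<Sum>X\<in>Pow A. f (insert a X))"
    using assms by (subst sum.reindex) (auto simp: inj_on_def)
  finally show ?thesis by (simp add: sum.distrib)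
qed

section \<open>Neighbourhoods and edge counts\<close>

definition nbrs :: "'a set set \<Rightarrow> 'a set \<Rightarrow> 'a \<Rightarrow> 'a set" where
  "nbrs E W v = {u \<in> W. {u, v} \<in> E}"

lemma finite_nbrs [simp]: "finite W \<Longrightarrow> finite (nbrs E W v)"
  by (simp add: nbrs_def)

lemma card_nbrs_split:
  "finite W \<Longrightarrow> A \<subseteq> W \<Longrightarrow> card (nbrs E W v) = card (nbrs E A v) + card (nbrs E (W - A) v)"
proof -
  assume "finite W" "A \<subseteq> W"
  then have "nbrs E W v = nbrs E A v \<union> nbrs E (W - A) v" "finite (nbrs E A v)"
    by (auto simp: nbrs_def intro: finite_subset)
  then show ?thesis
    using \<open>finite W\<close> by (simp add: card_Un_disjoint nbrs_def disjoint_iff)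
qed

lemma edges_between_commute: "edges_between E A B = edges_between E B A"
  by (auto simp: edges_between_def doubleton_eq_iff insert_commute)

lemma edges_between_eq_image:
  "edges_between E A B = (\<lambda>(u, v). {u, v}) ` {(u, v). u \<in> A \<and> v \<in> B \<and> {u, v} \<in> E}"
  by (auto simp: edges_between_def)

lemma finite_edges_between [simp]: "finite A \<Longrightarrow> finite B \<Longrightarrow> finite (edges_between E A B)"
  unfolding edges_between_eq_image
  by (rule finite_imageI, rule finite_subset [of _ "A \<times> B"]) auto

lemma card_edges_between_insert:
  assumes "finite A" "finite B" "w \<notin> A" "w \<notin> B"
  shows "card (edges_between E (insert w A) B) = card (edges_between E A B) + card (nbrs E B w)"
proof -
  have "edges_between E (insert w A) B = edges_between E A B \<union> (\<lambda>u. {u, w}) ` nbrs E B w"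
    by (auto simp: edges_between_def nbrs_def insert_commute)
  moreover have "edges_between E A B \<inter> (\<lambda>u. {u, w}) ` nbrs E B w = {}"
    using assms by (auto simp: edges_between_def nbrs_def doubleton_eq_iff)
  moreover have "card ((\<lambda>u. {u, w}) ` nbrs E B w) = card (nbrs E B w)"
    by (intro card_image) (auto simp: inj_on_def doubleton_eq_iff)
  ultimately show ?thesis
    using assms by (simp add: card_Un_disjoint)
qed

lemma card_induced_edges_insert:
  assumes "finite U" "w \<notin> U" "\<forall>e\<in>E. card e = 2"
  shows "card {e \<in> E. e \<subseteq> insert w U} = card {e \<in> E. e \<subseteq> U} + card (nbrs E U w)"
proof -
  have "{e \<in> E. e \<subseteq> insert w U} = {e \<in> E. e \<subseteq> U} \<union> (\<lambda>u. {u, w}) ` nbrs E U w"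
  proof (intro equalityI subsetI)
    fix e assume e: "e \<in> {e \<in> E. e \<subseteq> insert w U}"
    then obtain x y where xy: "e = {x, y}" "x \<noteq> y"
      using assms(3) by (auto simp: card_2_iff)
    show "e \<in> {e \<in> E. e \<subseteq> U} \<union> (\<lambda>u. {u, w}) ` nbrs E U w"
      using e xy assms(2) by (cases "x = w"; cases "y = w") (auto simp: nbrs_def insert_commute)
  qed (auto simp: nbrs_def)
  moreover have "{e \<in> E. e \<subseteq> U} \<inter> (\<lambda>u. {u, w}) ` nbrs E U w = {}"
    using assms by (auto simp: nbrs_def)
  moreover have "card ((\<lambda>u. {u, w}) ` nbrs E U w) = card (nbrs E U w)"
    by (intro card_image) (auto simp: inj_on_def doubleton_eq_iff)
  moreover have "finite {e \<in> E. e \<subseteq> U}"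
    using assms(1) by (auto intro: rev_finite_subset [of "Pow U"])
  ultimately show ?thesis
    using assms by (simp add: card_Un_disjoint)
qed

lemma fin_simple_graph_finite_edges: "fin_simple_graph V E \<Longrightarrow> finite E"
  unfolding fin_simple_graph_def by (intro finite_subset [of E "Pow V"]) auto

text \<open>The handshake lemma, by counting the incident pairs of a vertex and an edge in both
  orders.\<close>

lemma sum_card_nbrs:
  assumes "fin_simple_graph V E"
  shows "(\<Sum>v\<in>V. card (nbrs E V v)) = 2 * card E"
proof -
  have fin: "finite V" "finite E"
    using assms fin_simple_graph_finite_edges by (auto simp: fin_simple_graph_def)
  have "(\<Sum>v\<in>V. card (nbrs E V v)) = (\<Sum>v\<in>V. card {e \<in> E. v \<in> e})"
  proof (rule sum.cong)
    fix v assume v: "v \<in> V"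
    have "{e \<in> E. v \<in> e} = (\<lambda>u. {u, v}) ` nbrs E V v"
    proof (intro equalityI subsetI)
      fix e assume e: "e \<in> {e \<in> E. v \<in> e}"
      then obtain x y where "e = {x, y}" "x \<noteq> y" "x \<in> V" "y \<in> V"
        using assms by (fastforce simp: card_2_iff fin_simple_graph_def)
      then show "e \<in> (\<lambda>u. {u, v}) ` nbrs E V v"
        using e by (auto simp: nbrs_def image_iff insert_commute)
    qed (auto simp: nbrs_def)
    then show "card (nbrs E V v) = card {e \<in> E. v \<in> e}"
      by (simp add: card_image inj_on_def doubleton_eq_iff)
  qed simp
  also have "\<dots> = (\<Sum>e\<in>E. card {v \<in> V. v \<in> e})"
    unfolding card_eq_sum using fin by (rule sum.swap_restrict)
  also have "\<dots> = (\<Sum>e\<in>E. 2)"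
  proof (rule sum.cong)
    fix e assume "e \<in> E"
    then show "card {v \<in> V. v \<in> e} = 2"
      using assms by (auto simp: fin_simple_graph_def subset_iff Collect_conj_eq Int_absorb1)
  qed simp
  finally show ?thesis by simp
qed

section \<open>Keys, positions and the degree order\<close>

text \<open>The set \<open>X\<close> holds the left vertices. For \<open>0 < K v \<le> C\<close>,
  sorting by the key puts them first with \<open>K\<close> decreasing, then the others with
  \<open>K\<close> increasing, so that large \<open>K\<close>, meaning low degree, ends up on the
  outside.\<close>

definition key :: "('a \<Rightarrow> nat) \<Rightarrow> nat \<Rightarrow> 'a set \<Rightarrow> 'a \<Rightarrow> nat" where
  "key K C X v = (if v \<in> X then C - K v else C + K v)"

text \<open>A rank obtained by counting, so that two nested loops can compute it without moving
  data.\<close>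

definition position :: "'a set \<Rightarrow> ('a \<Rightarrow> nat) \<Rightarrow> nat \<Rightarrow> 'a set \<Rightarrow> 'a \<Rightarrow> nat" where
  "position V K C X v = card {u \<in> V. key K C X u < key K C X v}"

lemma position_less_card: "finite V \<Longrightarrow> v \<in> V \<Longrightarrow> position V K C X v < card V"
  unfolding position_def by (intro psubset_card_mono) auto

text \<open>\<open>K\<close> ranks the vertices by decreasing degree, and injectivity excludes ties.
  The coins are revealed in increasing order of \<open>K\<close>.\<close>

locale degree_order =
  fixes V :: "'a set" and E :: "'a set set" and K :: "'a \<Rightarrow> nat"
  assumes graph: "fin_simple_graph V E"
    and inj: "inj_on K V"
    and degree_mono: "u \<in> V \<Longrightarrow> v \<in> V \<Longrightarrow> K u < K v \<Longrightarrow> card (nbrs E V v) \<le> card (nbrs E V u)"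
begin

lemma finite_V [simp]: "finite V"
  using graph by (simp add: fin_simple_graph_def)

lemma finite_E [simp]: "finite E"
  using graph by (rule fin_simple_graph_finite_edges)

lemma card_edge: "e \<in> E \<Longrightarrow> card e = 2"
  using graph by (simp add: fin_simple_graph_def)

lemma edge_subset: "e \<in> E \<Longrightarrow> e \<subseteq> V"
  using graph by (simp add: fin_simple_graph_def)

text \<open>These vertices come last in the degree order, hence outermost on either side of the
  final ordering.\<close>

definition upper :: "nat \<Rightarrow> 'a set" where
  "upper j = {v \<in> V. j \<le> K v}"

definition back_deg :: "'a \<Rightarrow> nat" where
  "back_deg w = card (nbrs E {u \<in> V. K u < K w} w)"

text \<open>Every earlier neighbour of \<open>w\<close> has at least the degree of \<open>w\<close>,
  hence at least \<open>back_deg w\<close>. Summing this bound over those neighbours gives the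
  square, while all degrees together give \<open>2 * card E\<close>.\<close>

lemma back_square_le:
  assumes "w \<in> V"
  shows "(back_deg w)\<^sup>2 \<le> 2 * card E"
proof -
  define B where "B = nbrs E {u \<in> V. K u < K w} w"
  have B: "B \<subseteq> V" "\<And>u. u \<in> B \<Longrightarrow> K u < K w"
    by (auto simp: B_def nbrs_def)
  have "card B \<le> card (nbrs E V w)"
    by (intro card_mono) (auto simp: B_def nbrs_def)
  then have deg: "card B \<le> card (nbrs E V u)" if "u \<in> B" for u
    using degree_mono [of u w] B that assms by (meson le_trans subsetD)
  have "(back_deg w)\<^sup>2 = (\<Sum>u\<in>B. card B)"
    by (simp add: back_deg_def B_def power2_eq_square)
  also have "\<dots> \<le> (\<Sum>u\<in>B. card (nbrs E V u))"
    by (intro sum_mono deg)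
  also have "\<dots> \<le> (\<Sum>u\<in>V. card (nbrs E V u))"
    using B by (intro sum_mono2) auto
  finally show ?thesis
    using sum_card_nbrs [OF graph] by simp
qed

text \<open>Injectivity of \<open>K\<close> turns the non-strict bound supplied by the ranking
  induction into a strict one.\<close>

lemma nbrs_induct_step:
  assumes "insert w U \<subseteq> V" "\<And>y. y \<in> U \<Longrightarrow> K y \<le> K w" "w \<notin> U"
  shows "nbrs E U w \<subseteq> nbrs E {u \<in> V. K u < K w} w"
proof
  fix u assume u: "u \<in> nbrs E U w"
  then have "K u \<noteq> K w"
    using assms inj by (auto simp: nbrs_def dest: inj_onD)
  then show "u \<in> nbrs E {u \<in> V. K u < K w} w"
    using u assms by (fastforce simp: nbrs_def)
qed

text \<open>Every edge is counted exactly once, at its later endpoint.\<close>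

lemma sum_back: "(\<Sum>w\<in>V. back_deg w) = card E"
proof -
  \<comment> \<open>The claim is generalised to sets closed downwards in the degree order: there the
    earlier neighbours of the newly added vertex already lie in \<open>U\<close>.\<close>
  have "U \<subseteq> V \<Longrightarrow> (\<forall>u\<in>V. \<forall>w\<in>U. K u < K w \<longrightarrow> u \<in> U) \<Longrightarrow>
      (\<Sum>w\<in>U. back_deg w) = card {e \<in> E. e \<subseteq> U}" if "finite U" for U
    using that
  proof (induction U rule: finite_ranking_induct [where f = K])
    case empty
    have "{e \<in> E. e \<subseteq> {}} = {}"
      using card_edge by fastforce
    then show ?case by simp
  next
    case (insert w U)
    show ?case
    proof (cases "w \<in> U")
      case True
      then show ?thesis using insert by (simp add: insert_absorb)
    next
      case False
      have down: "\<forall>u\<in>V. \<forall>w\<in>U. K u < K w \<longrightarrow> u \<in> U"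
      proof safe
        fix u v assume uv: "u \<in> V" "v \<in> U" "K u < K v"
        then have "u \<in> insert w U" using insert.prems by blast
        moreover have "u \<noteq> w" using uv insert.hyps(2) [of v] by auto
        ultimately show "u \<in> U" by simp
      qed
      have "nbrs E {u \<in> V. K u < K w} w \<subseteq> nbrs E U w"
        using insert.prems by (fastforce simp: nbrs_def)
      then have "nbrs E {u \<in> V. K u < K w} w = nbrs E U w"
        using nbrs_induct_step [OF insert.prems(1) insert.hyps(2) False] by blast
      then show ?thesis
        using insert False down card_edge
        by (simp add: card_induced_edges_insert back_deg_def)
    qed
  qed
  from this [of V] show ?thesis
    using edge_subset by (simp add: Collect_conj_eq Int_absorb2 subset_iff)
qed

text \<open>One factor of each square is bounded by \<open>2 * sqrt m\<close>, and the remaining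
  factors sum to \<open>m\<close>.\<close>

lemma sum_back_square: "(\<Sum>w\<in>V. (real (back_deg w))\<^sup>2) \<le> 2 * real (card E) powr (3 / 2)"
proof -
  define m where "m = real (card E)"
  have b: "real (back_deg w) \<le> 2 * sqrt m" if "w \<in> V" for w
  proof (rule power2_le_imp_le)
    have "(real (back_deg w))\<^sup>2 \<le> 2 * m"
      using back_square_le [OF that] unfolding m_def
      by (metis of_nat_le_iff of_nat_mult of_nat_numeral of_nat_power)
    also have "\<dots> \<le> (2 * sqrt m)\<^sup>2"
      by (simp add: power_mult_distrib m_def)
    finally show "(real (back_deg w))\<^sup>2 \<le> (2 * sqrt m)\<^sup>2" .
  qed (simp add: m_def)
  have "(\<Sum>w\<in>V. (real (back_deg w))\<^sup>2) \<le> (\<Sum>w\<in>V. 2 * sqrt m * real (back_deg w))"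
    unfolding power2_eq_square by (intro sum_mono mult_right_mono b) auto
  also have "\<dots> = 2 * sqrt m * real (\<Sum>w\<in>V. back_deg w)"
    by (simp add: sum_distrib_left)
  also have "\<dots> = 2 * (m powr (1 / 2) * m powr 1)"
    by (simp add: sum_back m_def powr_half_sqrt)
  also have "\<dots> = 2 * m powr (3 / 2)"
    by (subst powr_add [symmetric]) simp
  finally show ?thesis by (simp add: m_def)
qed

text \<open>
  Revealing the sides in increasing order of \<open>K\<close>, the quantity \<open>2 * cut - edges\<close> of the graph
  revealed so far changes by \<open>\<plusminus>(b - 2 * a)\<close> when \<open>w\<close> is added, where \<open>b\<close> is the number of
  revealed neighbours and \<open>a\<close> the number of those lying in the cut set.
\<close>
lemma exp_moment_induced:
  fixes l :: real
  assumes "finite U" "U \<subseteq> V" "l \<ge> 0"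
  shows "(\<Sum>X\<in>Pow U. exp (l * (2 * card (edges_between E (X \<inter> upper j) (U - X \<inter> upper j))
            - real (card {e \<in> E. e \<subseteq> U}))))
        \<le> 2 ^ card U * exp (l\<^sup>2 / 2 * (\<Sum>w\<in>U. (real (back_deg w))\<^sup>2))"
  using assms
proof (induction U rule: finite_ranking_induct [where f = K])
  case empty
  then show ?case
    by (simp add: edges_between_def)
next
  case (insert w U)
  show ?case
  proof (cases "w \<in> U")
    case True
    then show ?thesis using insert by (simp add: insert_absorb)
  next
    case False
    define T where "T = upper j"
    define \<Phi> where "\<Phi> = (\<lambda>U X. 2 * card (edges_between E (X \<inter> T) (U - X \<inter> T))
            - real (card {e \<in> E. e \<subseteq> U}))"
    define b where "b = card (nbrs E U w)"
    have "b \<le> back_deg w"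
      unfolding b_def back_deg_def
      using nbrs_induct_step [OF insert.prems(1) insert.hyps(2) False] by (intro card_mono) auto
    \<comment> \<open>Pairing \<open>X\<close> with \<open>insert w X\<close> averages over the coin
      of \<open>w\<close>, all earlier coins being fixed.\<close>
    have step: "exp (l * \<Phi> (insert w U) X) + exp (l * \<Phi> (insert w U) (insert w X))
        \<le> exp (l * \<Phi> U X) * (2 * exp (l\<^sup>2 / 2 * (real (back_deg w))\<^sup>2))" if X: "X \<subseteq> U" for X
    proof -
      define A where "A = X \<inter> T"
      define a where "a = card (nbrs E A w)"
      have A: "A \<subseteq> U" "finite A" "w \<notin> A"
        using X False insert.hyps(1) by (auto simp: A_def intro: finite_subset)
      have b_eq: "b = a + card (nbrs E (U - A) w)"
        unfolding b_def a_def using insert.hyps(1) A by (intro card_nbrs_split) auto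
      have "insert w U - A = insert w (U - A)"
        using A by auto
      \<comment> \<open>With \<open>w\<close> outside the cut set, \<open>a\<close> of the
        \<open>b\<close> new edges are cut.\<close>
      then have out: "\<Phi> (insert w U) X = \<Phi> U X + (2 * real a - real b)"
        using A False insert.hyps(1) card_edge
        by (simp add: \<Phi>_def b_def a_def card_edges_between_insert card_induced_edges_insert
            edges_between_commute [of E A] flip: A_def)
      show ?thesis
      proof (cases "w \<in> T")
        case True
        then have "insert w X \<inter> T = insert w A" "insert w U - insert w A = U - A"
          using False A by (auto simp: A_def)
        \<comment> \<open>With \<open>w\<close> inside the cut set, the other \<open>b - a\<close>
          new edges are cut, so the change has the opposite sign.\<close>
        then have inn: "\<Phi> (insert w U) (insert w X) = \<Phi> U X - (2 * real a - real b)"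
          using A False insert.hyps(1) card_edge b_eq
          by (simp add: \<Phi>_def b_def a_def card_edges_between_insert card_induced_edges_insert
              flip: A_def)
        have "exp (l * \<Phi> (insert w U) X) + exp (l * \<Phi> (insert w U) (insert w X))
            = exp (l * \<Phi> U X) * (2 * cosh (l * (2 * real a - real b)))"
          unfolding out inn by (rule exp_shift_sum)
        also have "cosh (l * (2 * real a - real b)) \<le> exp ((l * (2 * real a - real b))\<^sup>2 / 2)"
          by (rule cosh_le_exp_half_square)
        \<comment> \<open>Since \<open>0 \<le> a \<le> b\<close>, the change is at most
          \<open>b\<close> in absolute value.\<close>
        also have "(2 * real a - real b)\<^sup>2 \<le> (real (back_deg w))\<^sup>2"
          using \<open>b \<le> back_deg w\<close> b_eq by (intro power2_le_iff_abs_le [THEN iffD2]) auto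
        then have "exp ((l * (2 * real a - real b))\<^sup>2 / 2) \<le> exp (l\<^sup>2 / 2 * (real (back_deg w))\<^sup>2)"
          by (simp add: power_mult_distrib mult_left_mono)
        finally show ?thesis by simp
      next
        \<comment> \<open>Below level \<open>j\<close> the cut set is still empty, because
          \<open>w\<close> comes after all of \<open>U\<close>. The coin of \<open>w\<close> then
          has no effect and \<Phi> can only drop, which does not raise the exponential because
          \<open>l \<ge> 0\<close>.\<close>
        case wT: False
        have "A = {}"
        proof -
          have "j > K w"
            using wT insert.prems by (auto simp: T_def upper_def)
          then show ?thesis
            using insert.hyps(2) X by (fastforce simp: A_def T_def upper_def)
        qed
        then have "\<Phi> (insert w U) X \<le> \<Phi> U X"
          using out by (simp add: a_def nbrs_def)
        moreover have "exp (l * \<Phi> (insert w U) (insert w X)) = exp (l * \<Phi> (insert w U) X)"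
          using wT by (simp add: \<Phi>_def Int_insert_left)
        moreover have "exp (l * \<Phi> U X) * 1 \<le> exp (l * \<Phi> U X) * exp (l\<^sup>2 / 2 * (real (back_deg w))\<^sup>2)"
          by (intro mult_left_mono) auto
        moreover have "exp (l * \<Phi> (insert w U) X) \<le> exp (l * \<Phi> U X)"
          using calculation(1) insert.prems by (simp add: mult_left_mono)
        ultimately show ?thesis by linarith
      qed
    qed
    have "(\<Sum>X\<in>Pow (insert w U). exp (l * \<Phi> (insert w U) X))
        = (\<Sum>X\<in>Pow U. exp (l * \<Phi> (insert w U) X) + exp (l * \<Phi> (insert w U) (insert w X)))"
      using insert.hyps(1) False by (rule sum_Pow_insert)
    also have "\<dots> \<le> (\<Sum>X\<in>Pow U. exp (l * \<Phi> U X) * (2 * exp (l\<^sup>2 / 2 * (real (back_deg w))\<^sup>2)))"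
      by (intro sum_mono step) auto
    also have "\<dots> = (\<Sum>X\<in>Pow U. exp (l * \<Phi> U X)) * (2 * exp (l\<^sup>2 / 2 * (real (back_deg w))\<^sup>2))"
      by (simp add: sum_distrib_right)
    also have "\<dots> \<le> (2 ^ card U * exp (l\<^sup>2 / 2 * (\<Sum>w\<in>U. (real (back_deg w))\<^sup>2)))
        * (2 * exp (l\<^sup>2 / 2 * (real (back_deg w))\<^sup>2))"
      using insert.IH insert.prems by (intro mult_right_mono) (auto simp: \<Phi>_def T_def)
    also have "\<dots> = 2 ^ card (insert w U) * exp (l\<^sup>2 / 2 * (\<Sum>w\<in>insert w U. (real (back_deg w))\<^sup>2))"
      using insert.hyps(1) False by (simp add: distrib_left exp_add)
    finally show ?thesis by (simp add: \<Phi>_def T_def)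
  qed
qed

section \<open>Tail bound for a single cut\<close>

definition cut :: "'a set \<Rightarrow> nat" where
  "cut A = card (edges_between E A (V - A))"

text \<open>All coins are revealed, and the bound on the sum of squares is inserted; its factor 2
  cancels the 1/2.\<close>

lemma exp_moment_cut:
  fixes l :: real
  assumes "l \<ge> 0"
  shows "(\<Sum>X\<in>Pow V. exp (l * (2 * cut (X \<inter> upper j) - real (card E))))
        \<le> 2 ^ card V * exp (l\<^sup>2 * real (card E) powr (3 / 2))"
proof -
  have "{e \<in> E. e \<subseteq> V} = E"
    using edge_subset by auto
  then have "(\<Sum>X\<in>Pow V. exp (l * (2 * cut (X \<inter> upper j) - real (card E))))
        \<le> 2 ^ card V * exp (l\<^sup>2 / 2 * (\<Sum>w\<in>V. (real (back_deg w))\<^sup>2))"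
    using exp_moment_induced [of V l j] assms by (simp add: cut_def)
  also have "l\<^sup>2 / 2 * (\<Sum>w\<in>V. (real (back_deg w))\<^sup>2) \<le> l\<^sup>2 / 2 * (2 * real (card E) powr (3 / 2))"
    by (intro mult_left_mono sum_back_square) auto
  finally show ?thesis by simp
qed

abbreviation threshold :: real where
  "threshold \<equiv> real (card E) / 2 + 7 * real (card E) powr (4 / 5)"

text \<open>Chernoff's method in counting form: Markov's inequality for the exponential
  moment.\<close>

lemma card_large_cut_left:
  assumes "E \<noteq> {}"
  shows "real (card {X \<in> Pow V. cut (X \<inter> upper j) > threshold})
      \<le> 2 ^ card V * exp (- 49 * real (card E) powr (1 / 10))"
proof -
  define m where "m = real (card E)"
  have m: "m > 0"
    using assms by (simp add: m_def card_gt_0_iff)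
  \<comment> \<open>This value minimises \<open>l\<^sup>2 * m powr (3 / 2) - l * t\<close>.\<close>
  define l where "l = 7 * m powr (- 7 / 10)"
  \<comment> \<open>Twice the permitted excess, because the moment bound concerns twice the cut
    minus \<open>m\<close>.\<close>
  define t where "t = 14 * m powr (4 / 5)"
  define B where "B = {X \<in> Pow V. cut (X \<inter> upper j) > threshold}"
  have "real (card B) * exp (l * t) = (\<Sum>X\<in>B. exp (l * t))"
    by simp
  also have "\<dots> \<le> (\<Sum>X\<in>B. exp (l * (2 * cut (X \<inter> upper j) - m)))"
  proof (rule sum_mono)
    fix X assume "X \<in> B"
    then have "t \<le> 2 * cut (X \<inter> upper j) - m"
      by (simp add: B_def m_def t_def)
    then show "exp (l * t) \<le> exp (l * (2 * cut (X \<inter> upper j) - m))"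
      by (simp add: l_def mult_left_mono)
  qed
  also have "\<dots> \<le> (\<Sum>X\<in>Pow V. exp (l * (2 * cut (X \<inter> upper j) - m)))"
    by (intro sum_mono2) (auto simp: B_def)
  also have "\<dots> \<le> 2 ^ card V * exp (l\<^sup>2 * m powr (3 / 2))"
    unfolding m_def by (intro exp_moment_cut) (simp add: l_def)
  also have "l\<^sup>2 * m powr (3 / 2) = 49 * m powr (1 / 10)"
    by (simp add: l_def power2_eq_square mult_ac flip: powr_add)
  finally have "real (card B) \<le> 2 ^ card V * exp (49 * m powr (1 / 10) - l * t)"
    by (simp add: exp_diff field_simps)
  also have "l * t = 98 * m powr (1 / 10)"
    by (simp add: l_def t_def mult_ac flip: powr_add)
  finally show ?thesis
    by (simp add: B_def m_def)
qed

text \<open>Replacing \<open>X\<close> by its complement permutes the coin outcomes and exchanges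
  the two sides.\<close>

lemma card_large_cut_right:
  assumes "E \<noteq> {}"
  shows "real (card {X \<in> Pow V. cut (upper j - X) > threshold})
      \<le> 2 ^ card V * exp (- 49 * real (card E) powr (1 / 10))"
proof -
  have "bij_betw (\<lambda>X. V - X) {X \<in> Pow V. cut (upper j - X) > threshold}
      {X \<in> Pow V. cut (X \<inter> upper j) > threshold}"
  proof (rule bij_betw_byWitness [where f' = "\<lambda>X. V - X"])
    have "(V - X) \<inter> upper j = upper j - X" "upper j - (V - X) = X \<inter> upper j" if "X \<subseteq> V" for X
      using that by (auto simp: upper_def)
    then show "(\<lambda>X. V - X) ` {X \<in> Pow V. cut (upper j - X) > threshold}
        \<subseteq> {X \<in> Pow V. cut (X \<inter> upper j) > threshold}"
      and "(\<lambda>X. V - X) ` {X \<in> Pow V. cut (X \<inter> upper j) > threshold}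
        \<subseteq> {X \<in> Pow V. cut (upper j - X) > threshold}"
      by auto
  qed auto
  then show ?thesis
    using card_large_cut_left [OF assms] by (simp add: bij_betw_same_card)
qed

section \<open>Union bound over all levels\<close>

text \<open>The good event for the coins: up to complement, every cut of the final ordering has one
  of these two forms.\<close>

definition balanced :: "'a set \<Rightarrow> bool" where
  "balanced X \<longleftrightarrow> (\<forall>j. cut (X \<inter> upper j) \<le> threshold \<and> cut (upper j - X) \<le> threshold)"

definition nonisolated :: "'a set" where
  "nonisolated = {v \<in> V. nbrs E V v \<noteq> {}}"

lemma finite_nonisolated [simp]: "finite nonisolated"
  by (simp add: nonisolated_def)

text \<open>Each of these vertices has degree at least 1, and the degrees sum to
  \<open>2 * card E\<close>.\<close>

lemma card_nonisolated: "card nonisolated \<le> 2 * card E"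
proof -
  have "card nonisolated \<le> (\<Sum>v\<in>nonisolated. card (nbrs E V v))"
    unfolding card_eq_sum by (intro sum_mono) (auto simp: nonisolated_def Suc_le_eq card_gt_0_iff
        simp flip: card_eq_sum)
  also have "\<dots> \<le> (\<Sum>v\<in>V. card (nbrs E V v))"
    by (intro sum_mono2) (auto simp: nonisolated_def)
  finally show ?thesis
    by (simp add: sum_card_nbrs [OF graph])
qed

text \<open>Both endpoints of an edge are nonisolated, so the other vertices cannot change which
  edges cross.\<close>

lemma cut_cong:
  assumes "A \<inter> nonisolated = B \<inter> nonisolated"
  shows "cut A = cut B"
proof -
  have "u \<in> nonisolated" "v \<in> nonisolated" if "{u, v} \<in> E" for u v
    using that edge_subset [OF that] by (auto simp: nonisolated_def nbrs_def insert_commute)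
  then have "edges_between E A (V - A) = edges_between E B (V - B)"
    unfolding edges_between_def using assms by (safe; (blast | fail))
  then show ?thesis by (simp add: cut_def)
qed

text \<open>Only the thresholds \<open>K u\<close> with \<open>u\<close> nonisolated matter; there are at most \<open>2 * card E\<close> of them,
  however many vertices there are.\<close>
lemma upper_nonisolated:
  "upper j \<inter> nonisolated = {} \<or> (\<exists>u\<in>nonisolated. upper j \<inter> nonisolated = upper (K u) \<inter> nonisolated)"
proof (cases "upper j \<inter> nonisolated = {}")
  case False
  \<comment> \<open>Raising the level to the least \<open>K\<close> among these vertices loses none
    of them.\<close>
  define k where "k = Min (K ` (upper j \<inter> nonisolated))"
  have "k \<in> K ` (upper j \<inter> nonisolated)"
    unfolding k_def using False by (intro Min_in) auto
  then obtain u where u: "u \<in> upper j" "u \<in> nonisolated" "k = K u"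
    by auto
  have "k \<le> K v" if "v \<in> upper j \<inter> nonisolated" for v
    unfolding k_def using that by (intro Min_le) auto
  then have "upper j \<inter> nonisolated = upper (K u) \<inter> nonisolated"
    using u by (fastforce simp: upper_def)
  then show ?thesis using u by blast
qed simp

lemma cut_empty: "cut {} = 0"
  by (simp add: cut_def edges_between_def)

text \<open>A level that contains no nonisolated vertex cuts no edge; every other level agrees with
  some \<open>K u\<close> on the nonisolated vertices.\<close>

lemma balancedI:
  assumes "\<And>u. u \<in> nonisolated \<Longrightarrow> cut (X \<inter> upper (K u)) \<le> threshold"
    and "\<And>u. u \<in> nonisolated \<Longrightarrow> cut (upper (K u) - X) \<le> threshold"
  shows "balanced X"
  unfolding balanced_def
proof
  fix j
  consider "upper j \<inter> nonisolated = {}"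
    | u where "u \<in> nonisolated" "upper j \<inter> nonisolated = upper (K u) \<inter> nonisolated"
    using upper_nonisolated by blast
  then show "cut (X \<inter> upper j) \<le> threshold \<and> cut (upper j - X) \<le> threshold"
  proof cases
    case 1
    then have "cut (X \<inter> upper j) = cut {}" "cut (upper j - X) = cut {}"
      by (auto intro!: cut_cong)
    then show ?thesis by (simp add: cut_empty)
  next
    case (2 u)
    then have "cut (X \<inter> upper j) = cut (X \<inter> upper (K u))"
      "cut (upper j - X) = cut (upper (K u) - X)"
      by (auto intro!: cut_cong)
    then show ?thesis using assms 2 by simp
  qed
qed

text \<open>Union bound over at most \<open>2 * card E\<close> levels and two sides. Without edges
  all cuts are empty.\<close>

lemma card_unbalanced: "3 * real (card {X \<in> Pow V. \<not> balanced X}) \<le> 2 ^ card V"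
proof (cases "E = {}")
  case True
  then have "balanced X" for X
    unfolding balanced_def cut_def edges_between_def by simp
  then show ?thesis by simp
next
  case False
  define m where "m = real (card E)"
  have m: "m > 0"
    using False by (simp add: m_def card_gt_0_iff)
  define L where "L = (\<lambda>u. {X \<in> Pow V. cut (X \<inter> upper (K u)) > threshold})"
  define R where "R = (\<lambda>u. {X \<in> Pow V. cut (upper (K u) - X) > threshold})"
  define p where "p = 2 ^ card V * exp (- 49 * m powr (1 / 10))"
  have "{X \<in> Pow V. \<not> balanced X} \<subseteq> (\<Union>u\<in>nonisolated. L u \<union> R u)"
    using balancedI by (force simp: L_def R_def not_le)
  then have "card {X \<in> Pow V. \<not> balanced X} \<le> card (\<Union>u\<in>nonisolated. L u \<union> R u)"
    by (intro card_mono) (auto simp: L_def R_def)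
  also have "\<dots> \<le> (\<Sum>u\<in>nonisolated. card (L u \<union> R u))"
    by (intro card_UN_le) auto
  also have "\<dots> \<le> (\<Sum>u\<in>nonisolated. card (L u) + card (R u))"
    by (intro sum_mono card_Un_le)
  finally have "real (card {X \<in> Pow V. \<not> balanced X})
      \<le> real (\<Sum>u\<in>nonisolated. card (L u) + card (R u))"
    by (rule of_nat_mono)
  also have "\<dots> = (\<Sum>u\<in>nonisolated. real (card (L u)) + real (card (R u)))"
    by simp
  also have "\<dots> \<le> (\<Sum>u\<in>nonisolated. p + p)"
    unfolding L_def R_def p_def m_def using False
    by (intro sum_mono add_mono card_large_cut_left card_large_cut_right)
  also have "\<dots> = real (card nonisolated) * (2 * p)"
    by simp
  also have "\<dots> \<le> (2 * m) * (2 * p)"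
    using card_nonisolated by (intro mult_right_mono) (auto simp: m_def p_def)
  \<comment> \<open>At most \<open>2 * m\<close> levels with two sides each, times 3.\<close>
  finally have "3 * real (card {X \<in> Pow V. \<not> balanced X}) \<le> 12 * m * p"
    by simp
  also have "12 * m * p \<le> 2 ^ card V"
  proof -
    \<comment> \<open>The chain is \<open>12 * m \<le> exp 49 * m = exp (49 + ln m) \<le> exp (49 *
      m powr (1 / 10))\<close>. The last step multiplies this inequality by 49 and uses
      \<open>ln m \<ge> 0\<close>.\<close>
    have "1 + ln m / 10 \<le> exp (ln m / 10)"
      by (rule exp_ge_add_one_self)
    then have "1 + ln m / 10 \<le> m powr (1 / 10)"
      using m by (simp add: powr_def)
    moreover have "ln m \<ge> 0"
      using m by (simp add: m_def)
    ultimately have "49 + ln m \<le> 49 * m powr (1 / 10)"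
      by linarith
    then have "exp (49 + ln m) \<le> exp (49 * m powr (1 / 10))"
      by simp
    moreover have "exp (49 + ln m) = exp 49 * m"
      using m by (simp add: exp_add)
    moreover have "1 + 49 \<le> exp (49 :: real)"
      by (rule exp_ge_add_one_self)
    then have "12 * m \<le> exp 49 * m"
      using m by (intro mult_right_mono) auto
    ultimately have "12 * m \<le> exp (49 * m powr (1 / 10))"
      by linarith
    then show ?thesis
      by (simp add: p_def exp_minus field_simps)
  qed
  finally show ?thesis .
qed

section \<open>Cuts of the ordering by keys\<close>

context
  fixes C :: nat and X :: "'a set"
  assumes K_bounds: "\<And>v. v \<in> V \<Longrightarrow> 0 < K v \<and> K v \<le> C"
begin

text \<open>By the bounds on \<open>K\<close>, left keys lie strictly below \<open>C\<close>, right
  keys strictly above, and no subtraction is truncated. So equal keys force equal sides and equal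
  \<open>K\<close>.\<close>

lemma inj_on_key: "inj_on (key K C X) V"
proof (rule inj_onI)
  fix u v assume *: "u \<in> V" "v \<in> V" "key K C X u = key K C X v"
  then have "K u = K v"
    using K_bounds [of u] K_bounds [of v] by (auto simp: key_def split: if_splits)
  then show "u = v" using * inj by (auto dest: inj_onD)
qed

lemma position_less_iff:
  assumes "u \<in> V" "v \<in> V"
  shows "position V K C X u < position V K C X v \<longleftrightarrow> key K C X u < key K C X v"
proof -
  have "position V K C X u < position V K C X v" if "u \<in> V" "key K C X u < key K C X v" for u v
    unfolding position_def using that by (intro psubset_card_mono) auto
  moreover have "position V K C X v \<le> position V K C X u" if "key K C X v \<le> key K C X u"
    unfolding position_def using that by (intro card_mono) auto
  ultimately show ?thesis
    using assms by (meson not_le)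
qed

text \<open>Positions are distinct and below \<open>card V\<close>, so each one is attained; this
  makes every step of the chain lose a vertex.\<close>

lemma bij_betw_position: "bij_betw (position V K C X) V {..<card V}"
proof -
  have inj_pos: "inj_on (position V K C X) V"
  proof (rule inj_onI)
    fix u v assume *: "u \<in> V" "v \<in> V" "position V K C X u = position V K C X v"
    then have "key K C X u = key K C X v"
      using position_less_iff [of u v] position_less_iff [of v u] by simp
    then show "u = v" using * inj_on_key by (auto dest: inj_onD)
  qed
  have "position V K C X ` V \<subseteq> {..<card V}"
    by (auto simp: position_less_card)
  moreover have "card (position V K C X ` V) = card {..<card V}"
    using inj_pos by (simp add: card_image)
  ultimately have "position V K C X ` V = {..<card V}"
    by (intro card_subset_eq) auto
  then show ?thesis using inj_pos by (simp add: bij_betw_def)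
qed

lemma cut_compl:
  assumes "A \<subseteq> V"
  shows "cut (V - A) = cut A"
  using assms by (simp add: cut_def double_diff edges_between_commute)

text \<open>A nonempty final segment consists of the vertices with key at least some \<theta>. If
  \<open>\<theta> \<le> C\<close>, its complement consists of outermost left vertices; otherwise the
  segment itself consists of outermost right vertices. Both cuts are covered by
  \<open>balanced\<close>.\<close>

lemma cut_final_segment:
  assumes "balanced X"
  shows "cut {v \<in> V. i \<le> position V K C X v} \<le> threshold"
proof (cases "{v \<in> V. i \<le> position V K C X v} = {}")
  case True
  then show ?thesis by (simp only: cut_empty) simp
next
  case False
  define S where "S = {v \<in> V. i \<le> position V K C X v}"
  define \<theta> where "\<theta> = Min (key K C X ` S)"
  have "\<theta> \<in> key K C X ` S"
    unfolding \<theta>_def using False by (intro Min_in) (auto simp: S_def)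
  then obtain w where w: "w \<in> S" "\<theta> = key K C X w" by auto
  have "\<theta> \<le> key K C X v" if "v \<in> S" for v
    unfolding \<theta>_def using that by (intro Min_le) (auto simp: S_def)
  moreover have "v \<in> S" if "v \<in> V" "\<theta> \<le> key K C X v" for v
    using that w position_less_iff [of v w] by (fastforce simp: S_def)
  ultimately have S: "S = {v \<in> V. \<theta> \<le> key K C X v}"
    by (auto simp: S_def)
  show ?thesis
  proof (cases "\<theta> \<le> C")
    case True
    \<comment> \<open>The successor comes from strictness: for a left vertex, a key below \<theta>
      means \<open>K v > C - \<theta>\<close>.\<close>
    have "V - S = X \<inter> upper (Suc (C - \<theta>)) \<inter> V"
      using True K_bounds by (auto simp: S key_def upper_def split: if_splits) force+
    then have "V - S = X \<inter> upper (Suc (C - \<theta>))"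
      by (auto simp: upper_def)
    moreover have "cut (V - S) = cut S"
      by (rule cut_compl) (auto simp: S_def)
    ultimately show ?thesis
      using assms unfolding balanced_def S_def by metis
  next
    case False
    then have "S = upper (\<theta> - C) - X"
      by (auto simp: S key_def upper_def split: if_splits)
    then show ?thesis
      using assms by (simp add: S_def balanced_def)
  qed
qed

text \<open>\<open>S\<close> is prescribed only up to index \<open>card V\<close>, since the output
  of the program is known only that far.\<close>

lemma low_cut_chain_position:
  assumes "balanced X" "\<And>i. i \<le> card V \<Longrightarrow> S i = {v \<in> V. i \<le> position V K C X v}"
  shows "low_cut_chain V E S"
  unfolding low_cut_chain_def
proof (intro conjI ballI allI impI)
  show "S 0 = V" by (simp add: assms)
  have "position V K C X v < card V" if "v \<in> V" for v
    using finite_V that by (rule position_less_card)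
  then show "S (card V) = {}" by (force simp: assms)
next
  fix i assume i: "i < card V"
  then have "i \<in> position V K C X ` V"
    using bij_betw_position by (simp add: bij_betw_def)
  then obtain v where "v \<in> V" "position V K C X v = i" by blast
  then have "v \<in> S i" "v \<notin> S (Suc i)" "S (Suc i) \<subseteq> S i"
    using i by (auto simp: assms(2))
  then show "S (Suc i) \<subset> S i" by blast
next
  fix i assume "i \<in> {1..card V}"
  then show "real (card (edges_between E (S i) (V - S i))) \<le> threshold"
    using cut_final_segment [OF assms(1), of i] by (simp add: assms(2) cut_def)
qed

end

end

section \<open>A concrete degree order and the existence of a chain\<close>

text \<open>For injective \<open>f\<close> with values below \<open>card V\<close>,
  \<open>f v\<close> is the last digit in base \<open>card V\<close> and breaks ties. Counting
  non-neighbours gives small keys to high degrees; in a simple graph \<open>v\<close> is its own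
  non-neighbour, which keeps its key positive.\<close>

definition degree_key :: "'a set \<Rightarrow> 'a set set \<Rightarrow> ('a \<Rightarrow> nat) \<Rightarrow> 'a \<Rightarrow> nat" where
  "degree_key V E f v = f v + card V * card {u \<in> V. {v, u} \<notin> E}"

text \<open>Leading digits decide the comparison, as \<open>y\<close> is a proper digit in base
  \<open>n\<close>.\<close>

lemma mult_add_less_imp_le:
  fixes n a b x y :: nat
  assumes "x + n * a < y + n * b" "y < n"
  shows "a \<le> b"
proof (rule ccontr)
  assume "\<not> a \<le> b"
  then have "n * (b + 1) \<le> n * a" by (intro mult_left_mono) auto
  then show False using assms by simp
qed

text \<open>Remainders modulo \<open>card V\<close> give injectivity. Leading digits give
  monotonicity, the degree being \<open>card V\<close> minus the number of non-neighbours.\<close>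

lemma degree_order_degree_key:
  assumes "fin_simple_graph V E" "inj_on f V" "f ` V \<subseteq> {..<card V}"
  shows "degree_order V E (degree_key V E f)"
proof
  show "inj_on (degree_key V E f) V"
  proof (rule inj_onI)
    fix u v assume "u \<in> V" "v \<in> V" "degree_key V E f u = degree_key V E f v"
    moreover have "degree_key V E f w mod card V = f w" if "w \<in> V" for w
      using assms(3) that by (auto simp: degree_key_def)
    ultimately have "f u = f v" by metis
    then show "u = v"
      using assms(2) \<open>u \<in> V\<close> \<open>v \<in> V\<close> by (auto dest: inj_onD)
  qed
next
  fix u v assume uv: "u \<in> V" "v \<in> V" "degree_key V E f u < degree_key V E f v"
  have fin: "finite V"
    using assms(1) by (simp add: fin_simple_graph_def)
  have deg: "card (nbrs E V w) = card V - card {x \<in> V. {w, x} \<notin> E}" for w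
  proof -
    have "nbrs E V w = V - {x \<in> V. {w, x} \<notin> E}"
      by (auto simp: nbrs_def insert_commute)
    then show ?thesis
      using fin by (simp add: card_Diff_subset)
  qed
  have "card {x \<in> V. {u, x} \<notin> E} \<le> card {x \<in> V. {v, x} \<notin> E}"
    using uv assms(3) unfolding degree_key_def by (intro mult_add_less_imp_le [of "f u" "card V"]) auto
  then show "card (nbrs E V v) \<le> card (nbrs E V u)"
    unfolding deg by (rule diff_le_mono2)
qed (use assms in auto)

text \<open>The number of non-neighbours lies between 1, for \<open>v\<close> itself, and
  \<open>card V\<close>. The upper bound is the value taken for \<open>C\<close>.\<close>

lemma degree_key_bounds:
  assumes "fin_simple_graph V E" "f ` V \<subseteq> {..<card V}" "v \<in> V"
  shows "0 < degree_key V E f v \<and> degree_key V E f v \<le> card V * card V + card V"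
proof
  have fin: "finite V"
    using assms(1) by (simp add: fin_simple_graph_def)
  have "{v, v} \<notin> E"
    using assms(1) by (fastforce simp: fin_simple_graph_def)
  then have "v \<in> {u \<in> V. {v, u} \<notin> E}"
    using assms(3) by simp
  then have "0 < card {u \<in> V. {v, u} \<notin> E}"
    using fin by (auto simp: card_gt_0_iff)
  moreover have "0 < card V"
    using assms(3) fin by (auto simp: card_gt_0_iff)
  ultimately show "0 < degree_key V E f v"
    by (simp add: degree_key_def)
  have "card {u \<in> V. {v, u} \<notin> E} \<le> card V"
    using fin by (intro card_mono) auto
  then have "card V * card {u \<in> V. {v, u} \<notin> E} \<le> card V * card V"
    by simp
  moreover have "f v < card V" using assms by auto
  ultimately show "degree_key V E f v \<le> card V * card V + card V"
    unfolding degree_key_def by linarith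
qed

text \<open>The probabilistic method: at most a third of all subsets are unbalanced, so a balanced
  one exists. An arbitrary enumeration \<open>f\<close> breaks the ties.\<close>

lemma ex_low_cut_chain:
  assumes "fin_simple_graph V E"
  shows "\<exists>S. low_cut_chain V E S"
proof -
  have fin: "finite V"
    using assms by (simp add: fin_simple_graph_def)
  then obtain f where "bij_betw f V {0..<card V}"
    using ex_bij_betw_finite_nat by blast
  then have f: "inj_on f V" "f ` V \<subseteq> {..<card V}"
    by (auto simp: bij_betw_def)
  interpret degree_order V E "degree_key V E f"
    using assms f by (rule degree_order_degree_key)
  have "{X \<in> Pow V. \<not> balanced X} \<noteq> Pow V"
  proof
    assume "{X \<in> Pow V. \<not> balanced X} = Pow V"
    then have "3 * (2 :: real) ^ card V \<le> 2 ^ card V"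
      using card_unbalanced fin by (simp add: card_Pow)
    then show False by simp
  qed
  then obtain X where "balanced X" by blast
  then have "low_cut_chain V E (\<lambda>i. {v \<in> V. i \<le> position V (degree_key V E f) (card V * card V + card V) X v})"
    using degree_key_bounds [OF assms f(2)] by (intro low_cut_chain_position) auto
  then show ?thesis by blast
qed

section \<open>Execution of while programs\<close>

text \<open>The bound \<open>T\<close> holds for every outcome of the coins, and \<open>D\<close> is
  the distribution of the final memory. Quantifying over all \<open>t \<ge> T\<close> allows bounds
  to be rounded up.\<close>

definition exec :: "nat \<Rightarrow> com \<Rightarrow> state \<Rightarrow> state pmf \<Rightarrow> bool" where
  "exec T c s D \<longleftrightarrow> (\<forall>t\<ge>T. run t c s = map_pmf (Pair Skip) D)"

lemma exec_mono: "exec T c s D \<Longrightarrow> T \<le> T' \<Longrightarrow> exec T' c s D"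
  by (auto simp: exec_def)

lemma run_Skip: "run t Skip s = return_pmf (Skip, s)"
  by (induction t) (simp_all add: bind_return_pmf)

lemma exec_Skip: "exec 0 Skip s (return_pmf s)"
  by (simp add: exec_def run_Skip)

text \<open>A coin changes the memory but not the control, so one continuation \<open>c'\<close>
  serves all outcomes of a step.\<close>

lemma execI_step:
  assumes "step c s = map_pmf (\<lambda>s'. (c', s')) D" "\<And>s'. s' \<in> set_pmf D \<Longrightarrow> exec T c' s' (g s')"
  shows "exec (Suc T) c s (bind_pmf D g)"
  unfolding exec_def
proof (intro allI impI)
  fix t assume "t \<ge> Suc T"
  then obtain t' where t': "t = Suc t'" "t' \<ge> T"
    by (cases t) auto
  have "run t c s = bind_pmf D (\<lambda>s'. run t' c' s')"
    by (simp add: t' assms(1) bind_map_pmf)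
  also have "\<dots> = bind_pmf D (\<lambda>s'. map_pmf (Pair Skip) (g s'))"
    using assms(2) t'(2) by (intro bind_pmf_cong) (auto simp: exec_def)
  finally show "run t c s = map_pmf (Pair Skip) (bind_pmf D g)"
    by (simp add: map_bind_pmf)
qed

lemma execI_det_step:
  assumes "step c s = return_pmf (c', s')" "exec T c' s' D"
  shows "exec (Suc T) c s D"
  using execI_step [of c s c' "return_pmf s'" T "\<lambda>_. D"] assms by (simp add: bind_return_pmf)

lemma exec_Assign: "exec 1 (Assign x a b) s (return_pmf (update s x (aval a s) (aval b s)))"
  using execI_det_step [OF _ exec_Skip] by simp

lemma exec_Flip:
  "exec 1 (Flip x a) s
     (map_pmf (\<lambda>b. update s x (aval a s) (of_bool b)) (bernoulli_pmf (1 / 2)))"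
  using execI_step [of "Flip x a" s Skip _ 0 return_pmf, OF _ exec_Skip]
  by (simp add: bind_return_pmf' map_pmf_comp)

lemma exec_If:
  assumes "aval a s \<noteq> 0 \<Longrightarrow> exec T c s D" "aval a s = 0 \<Longrightarrow> exec T d s D"
  shows "exec (Suc T) (If a c d) s D"
  by (rule execI_det_step [of _ _ "if aval a s \<noteq> 0 then c else d" s]) (use assms in auto)

text \<open>The extra 1 is the step that drops the finished first command.\<close>

lemma exec_Seq:
  assumes "exec T c s D" "\<And>s'. s' \<in> set_pmf D \<Longrightarrow> exec T' d s' (g s')"
  shows "exec (T + 1 + T') (Seq c d) s (bind_pmf D g)"
proof -
  have "run t (Seq c d) s = map_pmf (Pair Skip) (bind_pmf D g)"
    if "run T c s = map_pmf (Pair Skip) D" "\<And>s'. s' \<in> set_pmf D \<Longrightarrow> exec T' d s' (g s')"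
      "t \<ge> T + 1 + T'" for t T c s D
    using that
  proof (induction T arbitrary: t c s D)
    case 0
    \<comment> \<open>With no time left, the first command has halted already and \<open>D\<close>
      is a point mass.\<close>
    then have eq: "map_pmf (Pair Skip) D = return_pmf (c, s)" by simp
    then have "set_pmf (map_pmf (Pair Skip) D) = {(c, s)}"
      by simp
    then have "c = Skip"
      using set_pmf_not_empty [of D] by auto
    have "map_pmf snd (map_pmf (Pair Skip) D) = map_pmf snd (return_pmf (c, s))"
      by (simp only: eq)
    then have D: "D = return_pmf s"
      by (simp add: map_pmf_comp)
    have "exec (Suc T') (Seq c d) s (g s)"
      by (rule execI_det_step [of _ _ d s]) (use 0 D \<open>c = Skip\<close> in auto)
    then show ?case
      using 0 by (simp add: exec_def D bind_return_pmf)
  next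
    case (Suc T)
    show ?case
    proof (cases "c = Skip")
      case True
      then have "map_pmf snd (map_pmf (Pair Skip) D) = map_pmf snd (return_pmf (Skip, s))"
        using Suc.prems(1) by (simp only: run_Skip)
      then have D: "D = return_pmf s"
        by (simp add: map_pmf_comp)
      have "exec (Suc T') (Seq c d) s (g s)"
        by (rule execI_det_step [of _ _ d s]) (use Suc D True in auto)
      then show ?thesis
        using Suc.prems by (simp add: exec_def D bind_return_pmf)
    next
      case False
      obtain t' where t': "t = Suc t'" "t' \<ge> T + 1 + T'"
        using Suc.prems(3) by (cases t) auto
      \<comment> \<open>The distribution of the final memory when the first step leads to
        \<open>x\<close>. The whole run is supported on halted configurations, hence so is each
        continuation, and the induction hypothesis applies to it.\<close>
      define f where "f = (\<lambda>x. map_pmf snd (run T (fst x) (snd x)))"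
      have D: "D = bind_pmf (step c s) f"
      proof -
        have "D = map_pmf snd (run (Suc T) c s)"
          by (simp only: Suc.prems(1)) (simp add: map_pmf_comp)
        then show ?thesis
          by (simp add: map_bind_pmf f_def case_prod_beta)
      qed
      have run_f: "run T (fst x) (snd x) = map_pmf (Pair Skip) (f x)" if x: "x \<in> set_pmf (step c s)" for x
      proof -
        have "set_pmf (run T (fst x) (snd x)) \<subseteq> set_pmf (run (Suc T) c s)"
          using x by (force simp: case_prod_beta)
        also have "\<dots> \<subseteq> range (Pair Skip)"
          by (subst Suc.prems(1)) auto
        finally have "map_pmf (\<lambda>y. (Skip, snd y)) (run T (fst x) (snd x)) = map_pmf id (run T (fst x) (snd x))"
          by (intro map_pmf_cong) auto
        then show ?thesis
          by (simp add: f_def map_pmf_comp)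
      qed
      have "run t (Seq c d) s = bind_pmf (step c s) (\<lambda>x. run t' (Seq (fst x) d) (snd x))"
        using False by (simp add: t' bind_map_pmf case_prod_beta)
      also have "\<dots> = bind_pmf (step c s) (\<lambda>x. map_pmf (Pair Skip) (bind_pmf (f x) g))"
        using Suc.prems(2) t'(2)
        by (intro bind_pmf_cong refl Suc.IH run_f) (auto simp: D)
      finally show ?thesis
        by (simp add: D map_bind_pmf bind_assoc_pmf)
    qed
  qed
  then show ?thesis
    using assms by (auto simp: exec_def)
qed

text \<open>Everything after the coin flips is deterministic and can be followed state by
  state.\<close>

definition exec_det :: "nat \<Rightarrow> com \<Rightarrow> state \<Rightarrow> state \<Rightarrow> bool" where
  "exec_det T c s s' \<longleftrightarrow> exec T c s (return_pmf s')"

lemma exec_det_mono: "exec_det T c s s' \<Longrightarrow> T \<le> T' \<Longrightarrow> exec_det T' c s s'"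
  by (auto simp: exec_det_def intro: exec_mono)

lemma exec_det_Skip: "exec_det 0 Skip s s"
  by (simp add: exec_det_def exec_Skip)

lemma exec_det_Assign: "exec_det 1 (Assign x a b) s (update s x (aval a s) (aval b s))"
  unfolding exec_det_def by (rule exec_Assign)

lemma exec_det_Seq:
  "exec_det T c s s' \<Longrightarrow> exec_det T' d s' s'' \<Longrightarrow> exec_det (T + 1 + T') (Seq c d) s s''"
  using exec_Seq [of T c s "return_pmf s'" T' d "\<lambda>_. return_pmf s''"]
  by (simp add: exec_det_def bind_return_pmf)

lemma exec_det_If:
  "(aval a s \<noteq> 0 \<Longrightarrow> exec_det T c s s') \<Longrightarrow> (aval a s = 0 \<Longrightarrow> exec_det T d s s') \<Longrightarrow>
     exec_det (Suc T) (If a c d) s s'"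
  unfolding exec_det_def by (rule exec_If)

text \<open>The 3 extra steps unfold the loop, evaluate the test and drop the finished body.\<close>

lemma exec_While:
  assumes "aval a s \<noteq> 0" "exec T c s D" "\<And>s'. s' \<in> set_pmf D \<Longrightarrow> exec T' (While a c) s' (g s')"
  shows "exec (T + T' + 3) (While a c) s (bind_pmf D g)"
proof -
  have "exec (Suc (T + 1 + T')) (If a (Seq c (While a c)) Skip) s (bind_pmf D g)"
    using assms by (intro exec_If exec_Seq) auto
  then have "exec (Suc (Suc (T + 1 + T'))) (While a c) s (bind_pmf D g)"
    by (rule execI_det_step [rotated]) simp
  then show ?thesis by (simp add: numeral_eq_Suc)
qed

lemma exec_While_False:
  assumes "aval a s = 0"
  shows "exec 2 (While a c) s (return_pmf s)"
proof -
  have "exec (Suc 0) (If a (Seq c (While a c)) Skip) s (return_pmf s)"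
    using assms by (intro exec_If exec_Skip) auto
  then have "exec (Suc (Suc 0)) (While a c) s (return_pmf s)"
    by (rule execI_det_step [rotated]) simp
  then show ?thesis by (simp add: numeral_eq_Suc)
qed

section \<open>Counting loops\<close>

abbreviation Var :: "string \<Rightarrow> aexp" where
  "Var x \<equiv> Cell x (Const 0)"

text \<open>The truncated difference serves as the test \<open>x < n\<close>. The counter is not
  initialised here, so that inductions can enter the loop at any value.\<close>

definition Loop :: "string \<Rightarrow> com \<Rightarrow> com" where
  "Loop x c = While (Minus (Var ''n'') (Var x)) (Seq c (Assign x (Const 0) (Plus (Var x) (Const 1))))"

definition For :: "string \<Rightarrow> com \<Rightarrow> com" where
  "For x c = Seq (Assign x (Const 0) (Const 0)) (Loop x c)"

lemma update_apply: "update s x i k y j = (if y = x \<and> j = i then k else s y j)"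
  by (simp add: update_def)

text \<open>Loop rule with an invariant indexed by the counter. Each round spends 2 steps on the
  increment with its sequencing and 3 on the loop itself; the final 2 are the failing test.\<close>

lemma exec_det_Loop:
  assumes body: "\<And>k s. k < n \<Longrightarrow> I k s \<Longrightarrow> s x 0 = k \<Longrightarrow> s ''n'' 0 = n \<Longrightarrow>
      \<exists>s'. exec_det T c s s' \<and> s' x 0 = k \<and> s' ''n'' 0 = n \<and> I (Suc k) (update s' x 0 (Suc k))"
    and "x \<noteq> ''n''"
    and "k \<le> n" "I k s" "s x 0 = k" "s ''n'' 0 = n"
  shows "\<exists>s'. exec_det ((n - k) * (T + 5) + 2) (Loop x c) s s' \<and> s' x 0 = n \<and> s' ''n'' 0 = n \<and> I n s'"
  using assms(3-)
proof (induction "n - k" arbitrary: k s)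
  case 0
  then have "exec_det 2 (Loop x c) s s"
    unfolding Loop_def exec_det_def by (intro exec_While_False) auto
  then show ?case
    using 0 by (intro exI [of _ s]) (simp add: numeral_2_eq_2)
next
  case (Suc j)
  then have k: "k < n" by simp
  obtain s1 where s1: "exec_det T c s s1" "s1 x 0 = k" "s1 ''n'' 0 = n" "I (Suc k) (update s1 x 0 (Suc k))"
    using body [OF k] Suc.prems by blast
  define s2 where "s2 = update s1 x 0 (Suc k)"
  have "\<exists>s'. exec_det ((n - Suc k) * (T + 5) + 2) (Loop x c) s2 s' \<and> s' x 0 = n \<and> s' ''n'' 0 = n \<and> I n s'"
    using Suc.hyps k s1 \<open>x \<noteq> ''n''\<close> by (intro Suc.hyps(1)) (auto simp: s2_def update_apply)
  then obtain s' where s': "exec_det ((n - Suc k) * (T + 5) + 2) (Loop x c) s2 s'"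
      "s' x 0 = n" "s' ''n'' 0 = n" "I n s'" by blast
  have "exec_det (T + 1 + 1) (Seq c (Assign x (Const 0) (Plus (Var x) (Const 1)))) s s2"
    using exec_det_Seq [OF s1(1) exec_det_Assign [of x "Const 0" "Plus (Var x) (Const 1)"]] s1(2)
    by (simp add: s2_def)
  then have "exec_det (T + 1 + 1 + ((n - Suc k) * (T + 5) + 2) + 3) (Loop x c) s s'"
    using exec_While [of "Minus (Var ''n'') (Var x)" s "T + 1 + 1" _ "return_pmf s2"
        "(n - Suc k) * (T + 5) + 2" "\<lambda>_. return_pmf s'"] s'(1) k Suc.prems
    by (simp add: Loop_def exec_det_def bind_return_pmf)
  moreover have "(n - k) * (T + 5) = (T + 5) + (n - Suc k) * (T + 5)"
    using k by (metis Suc_diff_Suc mult_Suc)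
  then have "T + 1 + 1 + ((n - Suc k) * (T + 5) + 2) + 3 = (n - k) * (T + 5) + 2"
    by linarith
  ultimately have "exec_det ((n - k) * (T + 5) + 2) (Loop x c) s s'"
    by (simp only:)
  then show ?case using s' by blast
qed

lemma exec_det_For:
  assumes body: "\<And>k s. k < n \<Longrightarrow> I k s \<Longrightarrow> s x 0 = k \<Longrightarrow> s ''n'' 0 = n \<Longrightarrow>
      \<exists>s'. exec_det T c s s' \<and> s' x 0 = k \<and> s' ''n'' 0 = n \<and> I (Suc k) (update s' x 0 (Suc k))"
    and "x \<noteq> ''n''" "I 0 (update s x 0 0)" "s ''n'' 0 = n"
  shows "\<exists>s'. exec_det (n * (T + 5) + 4) (For x c) s s' \<and> s' x 0 = n \<and> s' ''n'' 0 = n \<and> I n s'"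
proof -
  have "\<exists>s'. exec_det ((n - 0) * (T + 5) + 2) (Loop x c) (update s x 0 0) s' \<and> s' x 0 = n \<and> s' ''n'' 0 = n \<and> I n s'"
    by (rule exec_det_Loop [where I = I]) (use assms in \<open>auto simp: update_apply\<close>)
  then obtain s' where s': "exec_det (n * (T + 5) + 2) (Loop x c) (update s x 0 0) s'"
    "s' x 0 = n" "s' ''n'' 0 = n" "I n s'" by auto
  have "exec_det (1 + 1 + (n * (T + 5) + 2)) (For x c) s s'"
    unfolding For_def using exec_det_Assign [of x "Const 0" "Const 0" s] s'(1)
    by (intro exec_det_Seq) auto
  then show ?thesis using s' by (auto simp: eval_nat_numeral)
qed

section \<open>The program\<close>

text \<open>A uniform random subset is a family of independent fair coins, from which the coin of
  \<open>a\<close> is split off.\<close>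

lemma pmf_of_set_Pow_insert:
  assumes "finite A" "a \<notin> A"
  shows "pmf_of_set (Pow (insert a A)) =
    bind_pmf (bernoulli_pmf (1 / 2)) (\<lambda>b. map_pmf (\<lambda>Y. if b then insert a Y else Y) (pmf_of_set (Pow A)))"
proof -
  have eq: "{x \<in> insert a A. (f(a := b)) x} = (if b then insert a {x \<in> A. f x} else {x \<in> A. f x})"
    for f b using assms(2) by auto
  have "pmf_of_set (Pow (insert a A)) =
    map_pmf (\<lambda>f. {x \<in> insert a A. f x}) (Pi_pmf (insert a A) False (\<lambda>_. bernoulli_pmf (1 / 2)))"
    using assms by (simp only: pmf_of_set_Pow_conv_bernoulli finite_insert)
  also have "\<dots> = bind_pmf (bernoulli_pmf (1 / 2)) (\<lambda>b.
      map_pmf (\<lambda>f. if b then insert a {x \<in> A. f x} else {x \<in> A. f x})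
        (Pi_pmf A False (\<lambda>_. bernoulli_pmf (1 / 2))))"
    by (simp only: Pi_pmf_insert [OF assms] pair_pmf_def map_bind_pmf map_return_pmf
        prod.case eq map_pmf_def bind_assoc_pmf bind_return_pmf)
  also have "\<dots> = bind_pmf (bernoulli_pmf (1 / 2)) (\<lambda>b.
      map_pmf (\<lambda>Y. if b then insert a Y else Y)
        (map_pmf (\<lambda>f. {x \<in> A. f x}) (Pi_pmf A False (\<lambda>_. bernoulli_pmf (1 / 2)))))"
    by (simp only: map_pmf_comp)
  also have "map_pmf (\<lambda>f. {x \<in> A. f x}) (Pi_pmf A False (\<lambda>_. bernoulli_pmf (1 / 2))) = pmf_of_set (Pow A)"
    using assms(1) by (rule pmf_of_set_Pow_conv_bernoulli)
  finally show ?thesis .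
qed

section \<open>The coin flips\<close>

text \<open>The counter \<open>''v''\<close> is 0 in the input memory, so \<open>Loop\<close> can be
  entered directly.\<close>

definition flip_phase :: com where
  "flip_phase = Loop ''v'' (Flip ''x'' (Var ''v''))"

text \<open>The memory once the coins from \<open>k\<close> on have come out as \<open>Y\<close>.
  Earlier cells keep their content, so that the coins can be added one at a time.\<close>

definition flipped :: "nat \<Rightarrow> nat \<Rightarrow> state \<Rightarrow> nat set \<Rightarrow> state" where
  "flipped k n s Y = s(''v'' := (s ''v'')(0 := n),
     ''x'' := (\<lambda>i. if i \<in> {k..<n} then of_bool (i \<in> Y) else s ''x'' i))"

text \<open>Induction on the number of remaining coins: the next flip decides whether
  \<open>k\<close> joins the random set, and the rest is uniform on the subsets of
  \<open>{Suc k..<n}\<close>.\<close>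

lemma exec_flip_phase:
  assumes "k \<le> n" "s ''v'' 0 = k" "s ''n'' 0 = n"
  shows "exec ((n - k) * 6 + 2) flip_phase s (map_pmf (flipped k n s) (pmf_of_set (Pow {k..<n})))"
  using assms
proof (induction "n - k" arbitrary: k s)
  case 0
  then have "k = n" by simp
  then have "flipped k n s {} = s"
    using 0 by (simp add: flipped_def fun_eq_iff)
  moreover have "exec 2 flip_phase s (return_pmf s)"
    unfolding flip_phase_def Loop_def using 0 by (intro exec_While_False) auto
  ultimately show ?case
    using \<open>k = n\<close> by (simp add: pmf_of_set_singleton numeral_2_eq_2)
next
  case (Suc j)
  then have k: "k < n" by simp
  define u where "u = (\<lambda>b. update (update s ''x'' k (of_bool b)) ''v'' 0 (Suc k))"
  define g where "g = (\<lambda>s. map_pmf (flipped (Suc k) n s) (pmf_of_set (Pow {Suc k..<n})))"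
  define D where "D = map_pmf u (bernoulli_pmf (1 / 2))"
  have "exec (1 + 1 + 1) (Seq (Flip ''x'' (Var ''v''))
      (Assign ''v'' (Const 0) (Plus (Var ''v'') (Const 1)))) s
      (bind_pmf (map_pmf (\<lambda>b. update s ''x'' k (of_bool b)) (bernoulli_pmf (1 / 2)))
        (\<lambda>s'. return_pmf (update s' ''v'' 0 (Suc (s' ''v'' 0)))))"
    using exec_Flip [of "''x''" "Var ''v''" s]
      exec_Assign [of "''v''" "Const 0" "Plus (Var ''v'') (Const 1)"] Suc.prems
    by (intro exec_Seq) auto
  also have "bind_pmf (map_pmf (\<lambda>b. update s ''x'' k (of_bool b)) (bernoulli_pmf (1 / 2)))
        (\<lambda>s'. return_pmf (update s' ''v'' 0 (Suc (s' ''v'' 0)))) = D"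
    using Suc.prems by (simp add: bind_map_pmf update_apply) (simp add: D_def u_def map_pmf_def)
  finally have body: "exec 3 (Seq (Flip ''x'' (Var ''v''))
      (Assign ''v'' (Const 0) (Plus (Var ''v'') (Const 1)))) s D"
    by (simp add: numeral_3_eq_3)
  have rest: "exec ((n - Suc k) * 6 + 2) flip_phase s' (g s')" if "s' \<in> set_pmf D" for s'
    unfolding g_def using that Suc.hyps(2) k Suc.prems
    by (intro Suc.hyps(1)) (auto simp: D_def u_def update_apply)
  have "exec (3 + ((n - Suc k) * 6 + 2) + 3) flip_phase s (bind_pmf D g)"
    unfolding flip_phase_def Loop_def
    using body rest k Suc.prems by (intro exec_While) (auto simp: flip_phase_def Loop_def)
  moreover have "bind_pmf D g = map_pmf (flipped k n s) (pmf_of_set (Pow {k..<n}))"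
  proof -
    have eq: "flipped (Suc k) n (u b) Y = flipped k n s (if b then insert k Y else Y)"
      if "Y \<subseteq> {Suc k..<n}" for b Y
      using that k by (auto simp: flipped_def u_def update_def fun_eq_iff)
    have "{k..<n} = insert k {Suc k..<n}"
      using k by auto
    then have "map_pmf (flipped k n s) (pmf_of_set (Pow {k..<n})) =
        bind_pmf (bernoulli_pmf (1 / 2)) (\<lambda>b.
          map_pmf (\<lambda>Y. flipped k n s (if b then insert k Y else Y)) (pmf_of_set (Pow {Suc k..<n})))"
      by (simp only: pmf_of_set_Pow_insert finite_atLeastLessThan atLeastLessThan_iff Suc_n_not_le_n
          simp_thms map_bind_pmf map_pmf_comp)
    moreover have "set_pmf (pmf_of_set (Pow {Suc k..<n})) = Pow {Suc k..<n}"
      by (rule set_pmf_of_set) auto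
    then have "bind_pmf (bernoulli_pmf (1 / 2)) (\<lambda>b.
          map_pmf (\<lambda>Y. flipped k n s (if b then insert k Y else Y)) (pmf_of_set (Pow {Suc k..<n}))) =
        bind_pmf (bernoulli_pmf (1 / 2)) (\<lambda>b.
          map_pmf (flipped (Suc k) n (u b)) (pmf_of_set (Pow {Suc k..<n})))"
      by (intro bind_pmf_cong map_pmf_cong refl eq [symmetric]) auto
    ultimately show ?thesis
      by (simp add: D_def g_def bind_map_pmf)
  qed
  moreover have "(n - k) * 6 + 2 = 3 + ((n - Suc k) * 6 + 2) + 3"
    using k by (simp add: Suc_diff_Suc)
  ultimately show ?case by simp
qed

section \<open>The deterministic phases and their correctness\<close>

text \<open>No multiplication is available: \<open>''i''\<close> walks through the matrix cell by
  cell, and \<open>n\<close> is added once per non-neighbour.\<close>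

definition degree_phase :: com where
  "degree_phase = For ''v'' (Seq (Assign ''key'' (Var ''v'') (Var ''v''))
     (For ''u'' (Seq
       (If (Cell ''adj'' (Var ''i'')) Skip
         (Assign ''key'' (Var ''v'') (Plus (Cell ''key'' (Var ''v'')) (Var ''n''))))
       (Assign ''i'' (Const 0) (Plus (Var ''i'') (Const 1))))))"

text \<open>The counter \<open>''i''\<close> still holds \<open>n * n\<close>, so its sum with
  \<open>n\<close> is the constant \<open>C\<close> of the keys.\<close>

definition key_phase :: com where
  "key_phase = For ''v'' (If (Cell ''x'' (Var ''v''))
     (Assign ''key'' (Var ''v'') (Minus (Plus (Var ''i'') (Var ''n'')) (Cell ''key'' (Var ''v''))))
     (Assign ''key'' (Var ''v'') (Plus (Plus (Var ''i'') (Var ''n'')) (Cell ''key'' (Var ''v'')))))"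

text \<open>The truncated difference of the keys is nonzero exactly when \<open>u\<close> comes
  before \<open>v\<close>.\<close>

definition position_phase :: com where
  "position_phase = For ''v'' (For ''u''
     (If (Minus (Cell ''key'' (Var ''v'')) (Cell ''key'' (Var ''u'')))
       (Assign ''pos'' (Var ''v'') (Plus (Cell ''pos'' (Var ''v'')) (Const 1)))
       Skip))"

text \<open>Since \<open>''out''\<close> starts at 0, the row of the empty set \<open>S n\<close> need not be written.\<close>
definition output_phase :: com where
  "output_phase = For ''v'' (For ''u'' (Seq
     (Assign ''out'' (Var ''j'') (Minus (Plus (Cell ''pos'' (Var ''u'')) (Const 1)) (Var ''v'')))
     (Assign ''j'' (Const 0) (Plus (Var ''j'') (Const 1)))))"

lemma card_Collect_less_Suc:
  "card {u. u < Suc l \<and> P u} = card {u. u < l \<and> P u} + of_bool (P l)"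
proof -
  have "{u. u < Suc l \<and> P u} = (if P l then insert l {u. u < l \<and> P u} else {u. u < l \<and> P u})"
    by (auto simp: less_Suc_eq)
  then show ?thesis by simp
qed

lemma degree_key_lessThan:
  "degree_key {..<n} E id v = v + n * card {u. u < n \<and> {v, u} \<notin> E}"
  by (simp add: degree_key_def)

lemma adj_entry:
  assumes "v < n" "u < n"
  shows "graph_input n E ''adj'' (v * n + u) = of_bool ({v, u} \<in> E)"
proof -
  have "v * n + u < (v + 1) * n" using assms by simp
  also have "\<dots> \<le> n * n" using assms by (intro mult_right_mono) auto
  finally show ?thesis
    using assms by (simp add: graph_input_def)
qed

lemma exec_degree_phase:
  assumes "s ''n'' 0 = n" "s ''i'' 0 = 0" "s ''adj'' = graph_input n E ''adj''"
  shows "\<exists>s'. exec_det (n * (n * 9 + 11) + 4) degree_phase s s' \<and>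
     (\<forall>y. y \<notin> {''v'', ''u'', ''i'', ''key''} \<longrightarrow> s' y = s y) \<and> s' ''i'' 0 = n * n \<and>
     (\<forall>v<n. s' ''key'' v = degree_key {..<n} E id v)"
proof -
  \<comment> \<open>\<open>F\<close> is the frame condition; \<open>I\<close> and \<open>J\<close>
    are the invariants of the outer and the inner loop, \<open>J\<close> recording the partly
    accumulated key of \<open>k\<close>.\<close>
  define F where "F = (\<lambda>s'. \<forall>y. y \<notin> {''v'', ''u'', ''i'', ''key''} \<longrightarrow> s' y = s y)"
  define I where "I = (\<lambda>k s'. F s' \<and> s' ''i'' 0 = k * n \<and> (\<forall>v<k. s' ''key'' v = degree_key {..<n} E id v))"
  define J where "J = (\<lambda>k l s'. F s' \<and> s' ''v'' 0 = k \<and> s' ''i'' 0 = k * n + l \<and>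
      (\<forall>v<k. s' ''key'' v = degree_key {..<n} E id v) \<and>
      s' ''key'' k = k + n * card {u. u < l \<and> {k, u} \<notin> E})"
  have "\<exists>s'. exec_det (n * (n * 9 + 6 + 5) + 4) degree_phase s s' \<and> s' ''v'' 0 = n \<and> s' ''n'' 0 = n \<and> I n s'"
    unfolding degree_phase_def
  proof (rule exec_det_For)
    fix k s1 assume 1: "k < n" "I k s1" "s1 ''v'' 0 = k" "s1 ''n'' 0 = n"
    define s2 where "s2 = update s1 ''key'' k k"
    have s2: "exec_det 1 (Assign ''key'' (Var ''v'') (Var ''v'')) s1 s2"
      using exec_det_Assign [of "''key''" "Var ''v''" "Var ''v''" s1] 1 by (simp add: s2_def)
    have "\<exists>s'. exec_det (n * (4 + 5) + 4) (For ''u'' (Seq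
       (If (Cell ''adj'' (Var ''i'')) Skip
         (Assign ''key'' (Var ''v'') (Plus (Cell ''key'' (Var ''v'')) (Var ''n''))))
       (Assign ''i'' (Const 0) (Plus (Var ''i'') (Const 1))))) s2 s' \<and>
       s' ''u'' 0 = n \<and> s' ''n'' 0 = n \<and> J k n s'"
    proof (rule exec_det_For)
      fix l s3 assume 3: "l < n" "J k l s3" "s3 ''u'' 0 = l" "s3 ''n'' 0 = n"
      define s4 where "s4 = (if {k, l} \<in> E then s3 else update s3 ''key'' k (s3 ''key'' k + n))"
      define s5 where "s5 = update s4 ''i'' 0 (k * n + l + 1)"
      have adj: "s3 ''adj'' (s3 ''i'' 0) = of_bool ({k, l} \<in> E)"
        using 3 1 adj_entry [of k n l E] assms(3) by (simp add: J_def F_def)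
      have "exec_det (Suc 1) (If (Cell ''adj'' (Var ''i'')) Skip
         (Assign ''key'' (Var ''v'') (Plus (Cell ''key'' (Var ''v'')) (Var ''n'')))) s3 s4"
      proof (rule exec_det_If)
        assume "aval (Cell ''adj'' (Var ''i'')) s3 \<noteq> 0"
        then show "exec_det 1 Skip s3 s4"
          using adj exec_det_mono [OF exec_det_Skip, of 1] by (simp add: s4_def split: if_splits)
      next
        assume "aval (Cell ''adj'' (Var ''i'')) s3 = 0"
        then show "exec_det 1 (Assign ''key'' (Var ''v'') (Plus (Cell ''key'' (Var ''v'')) (Var ''n''))) s3 s4"
          using adj 3 exec_det_Assign [of "''key''" "Var ''v''" "Plus (Cell ''key'' (Var ''v'')) (Var ''n'')" s3]
          by (simp add: s4_def J_def split: if_splits)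
      qed
      moreover have "s4 ''i'' 0 = k * n + l"
        using 3 by (simp add: s4_def J_def update_apply)
      then have "exec_det 1 (Assign ''i'' (Const 0) (Plus (Var ''i'') (Const 1))) s4 s5"
        using exec_det_Assign [of "''i''" "Const 0" "Plus (Var ''i'') (Const 1)" s4]
        by (simp add: s5_def)
      ultimately have "exec_det (Suc 1 + 1 + 1) (Seq (If (Cell ''adj'' (Var ''i'')) Skip
         (Assign ''key'' (Var ''v'') (Plus (Cell ''key'' (Var ''v'')) (Var ''n''))))
         (Assign ''i'' (Const 0) (Plus (Var ''i'') (Const 1)))) s3 s5"
        by (rule exec_det_Seq)
      moreover have "s5 ''u'' 0 = l" "s5 ''n'' 0 = n"
        using 3 by (auto simp: s5_def s4_def update_apply)
      moreover have "J k (Suc l) (update s5 ''u'' 0 (Suc l))"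
        using 3 by (auto simp: J_def F_def s5_def s4_def update_def card_Collect_less_Suc distrib_left)
      ultimately show "\<exists>s'. exec_det 4 (Seq (If (Cell ''adj'' (Var ''i'')) Skip
         (Assign ''key'' (Var ''v'') (Plus (Cell ''key'' (Var ''v'')) (Var ''n''))))
         (Assign ''i'' (Const 0) (Plus (Var ''i'') (Const 1)))) s3 s' \<and>
         s' ''u'' 0 = l \<and> s' ''n'' 0 = n \<and> J k (Suc l) (update s' ''u'' 0 (Suc l))"
        by (intro exI [of _ s5]) (simp add: eval_nat_numeral)
    next
      show "J k 0 (update s2 ''u'' 0 0)"
        using 1 by (auto simp: J_def I_def F_def s2_def update_def)
    qed (use 1 in \<open>auto simp: s2_def update_apply\<close>)
    then obtain s6 where s6: "exec_det (n * 9 + 4) (For ''u'' (Seq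
       (If (Cell ''adj'' (Var ''i'')) Skip
         (Assign ''key'' (Var ''v'') (Plus (Cell ''key'' (Var ''v'')) (Var ''n''))))
       (Assign ''i'' (Const 0) (Plus (Var ''i'') (Const 1))))) s2 s6"
       "s6 ''n'' 0 = n" "J k n s6"
      by auto
    have "I (Suc k) (update s6 ''v'' 0 (Suc k))"
      using s6 by (auto simp: I_def J_def F_def update_def less_Suc_eq degree_key_lessThan)
    then show "\<exists>s'. exec_det (n * 9 + 6) (Seq (Assign ''key'' (Var ''v'') (Var ''v''))
     (For ''u'' (Seq
       (If (Cell ''adj'' (Var ''i'')) Skip
         (Assign ''key'' (Var ''v'') (Plus (Cell ''key'' (Var ''v'')) (Var ''n''))))
       (Assign ''i'' (Const 0) (Plus (Var ''i'') (Const 1)))))) s1 s' \<and>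
       s' ''v'' 0 = k \<and> s' ''n'' 0 = n \<and> I (Suc k) (update s' ''v'' 0 (Suc k))"
      using exec_det_Seq [OF s2 s6(1)] s6(2,3)
      by (intro exI [of _ s6]) (auto simp: J_def eval_nat_numeral)
  next
    show "I 0 (update s ''v'' 0 0)"
      using assms by (auto simp: I_def F_def update_def)
  qed (use assms in auto)
  then obtain s' where "exec_det (n * (n * 9 + 11) + 4) degree_phase s s'" "I n s'"
    by (auto simp: add.assoc)
  then show ?thesis
    by (intro exI [of _ s']) (simp add: I_def F_def)
qed

lemma exec_key_phase:
  assumes "s ''n'' 0 = n"
  shows "\<exists>s'. exec_det (n * 7 + 4) key_phase s s' \<and>
     (\<forall>y. y \<notin> {''v'', ''key''} \<longrightarrow> s' y = s y) \<and>
     (\<forall>v<n. s' ''key'' v = (if s ''x'' v \<noteq> 0 then s ''i'' 0 + n - s ''key'' v else s ''i'' 0 + n + s ''key'' v))"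
proof -
  define f where "f = (\<lambda>v. if s ''x'' v \<noteq> 0 then s ''i'' 0 + n - s ''key'' v else s ''i'' 0 + n + s ''key'' v)"
  \<comment> \<open>Keys are rewritten in place, so the invariant also keeps the old values from
    \<open>k\<close> on.\<close>
  define I where "I = (\<lambda>k s'. (\<forall>y. y \<notin> {''v'', ''key''} \<longrightarrow> s' y = s y) \<and>
      (\<forall>v. s' ''key'' v = (if v < k then f v else s ''key'' v)))"
  have "\<exists>s'. exec_det (n * (2 + 5) + 4) key_phase s s' \<and> s' ''v'' 0 = n \<and> s' ''n'' 0 = n \<and> I n s'"
    unfolding key_phase_def
  proof (rule exec_det_For)
    fix k s1 assume 1: "k < n" "I k s1" "s1 ''v'' 0 = k" "s1 ''n'' 0 = n"
    define s2 where "s2 = update s1 ''key'' k (f k)"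
    have "exec_det (Suc 1) (If (Cell ''x'' (Var ''v''))
     (Assign ''key'' (Var ''v'') (Minus (Plus (Var ''i'') (Var ''n'')) (Cell ''key'' (Var ''v''))))
     (Assign ''key'' (Var ''v'') (Plus (Plus (Var ''i'') (Var ''n'')) (Cell ''key'' (Var ''v''))))) s1 s2"
    proof (rule exec_det_If)
      assume "aval (Cell ''x'' (Var ''v'')) s1 \<noteq> 0"
      then show "exec_det 1 (Assign ''key'' (Var ''v'')
          (Minus (Plus (Var ''i'') (Var ''n'')) (Cell ''key'' (Var ''v'')))) s1 s2"
        using 1 exec_det_Assign [of "''key''" "Var ''v''"
            "Minus (Plus (Var ''i'') (Var ''n'')) (Cell ''key'' (Var ''v''))" s1]
        by (simp add: s2_def f_def I_def)
    next
      assume "aval (Cell ''x'' (Var ''v'')) s1 = 0"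
      then show "exec_det 1 (Assign ''key'' (Var ''v'')
          (Plus (Plus (Var ''i'') (Var ''n'')) (Cell ''key'' (Var ''v'')))) s1 s2"
        using 1 exec_det_Assign [of "''key''" "Var ''v''"
            "Plus (Plus (Var ''i'') (Var ''n'')) (Cell ''key'' (Var ''v''))" s1]
        by (simp add: s2_def f_def I_def)
    qed
    moreover have "s2 ''v'' 0 = k" "s2 ''n'' 0 = n" "I (Suc k) (update s2 ''v'' 0 (Suc k))"
      using 1 by (auto simp: s2_def I_def update_def less_Suc_eq)
    ultimately show "\<exists>s'. exec_det 2 (If (Cell ''x'' (Var ''v''))
     (Assign ''key'' (Var ''v'') (Minus (Plus (Var ''i'') (Var ''n'')) (Cell ''key'' (Var ''v''))))
     (Assign ''key'' (Var ''v'') (Plus (Plus (Var ''i'') (Var ''n'')) (Cell ''key'' (Var ''v''))))) s1 s' \<and>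
      s' ''v'' 0 = k \<and> s' ''n'' 0 = n \<and> I (Suc k) (update s' ''v'' 0 (Suc k))"
      by (intro exI [of _ s2]) (simp add: eval_nat_numeral)
  next
    show "I 0 (update s ''v'' 0 0)"
      by (auto simp: I_def update_def)
  qed (use assms in auto)
  then obtain s' where "exec_det (n * 7 + 4) key_phase s s'" "I n s'"
    by auto
  then show ?thesis
    by (intro exI [of _ s']) (simp add: I_def f_def)
qed

lemma exec_position_phase:
  assumes "s ''n'' 0 = n" "s ''pos'' = (\<lambda>_. 0)"
  shows "\<exists>s'. exec_det (n * (n * 7 + 9) + 4) position_phase s s' \<and>
     (\<forall>y. y \<notin> {''v'', ''u'', ''pos''} \<longrightarrow> s' y = s y) \<and>
     (\<forall>v<n. s' ''pos'' v = card {u. u < n \<and> s ''key'' u < s ''key'' v})"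
proof -
  define F where "F = (\<lambda>s'. \<forall>y. y \<notin> {''v'', ''u'', ''pos''} \<longrightarrow> s' y = s y)"
  define p where "p = (\<lambda>l v. card {u. u < l \<and> s ''key'' u < s ''key'' v})"
  \<comment> \<open>The zeros from \<open>k\<close> on belong to the invariant because each count
    starts from the initial content of \<open>''pos''\<close>.\<close>
  define I where "I = (\<lambda>k s'. F s' \<and> (\<forall>v. s' ''pos'' v = (if v < k then p n v else 0)))"
  define J where "J = (\<lambda>k l s'. F s' \<and> s' ''v'' 0 = k \<and>
      (\<forall>v. s' ''pos'' v = (if v < k then p n v else if v = k then p l v else 0)))"
  have "\<exists>s'. exec_det (n * (n * 7 + 4 + 5) + 4) position_phase s s' \<and> s' ''v'' 0 = n \<and> s' ''n'' 0 = n \<and> I n s'"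
    unfolding position_phase_def
  proof (rule exec_det_For)
    fix k s1 assume 1: "k < n" "I k s1" "s1 ''v'' 0 = k" "s1 ''n'' 0 = n"
    have "\<exists>s'. exec_det (n * (2 + 5) + 4) (For ''u''
       (If (Minus (Cell ''key'' (Var ''v'')) (Cell ''key'' (Var ''u'')))
         (Assign ''pos'' (Var ''v'') (Plus (Cell ''pos'' (Var ''v'')) (Const 1)))
         Skip)) s1 s' \<and> s' ''u'' 0 = n \<and> s' ''n'' 0 = n \<and> J k n s'"
    proof (rule exec_det_For)
      fix l s3 assume 3: "l < n" "J k l s3" "s3 ''u'' 0 = l" "s3 ''n'' 0 = n"
      define s4 where "s4 = (if s ''key'' l < s ''key'' k then update s3 ''pos'' k (s3 ''pos'' k + 1) else s3)"
      have "exec_det (Suc 1) (If (Minus (Cell ''key'' (Var ''v'')) (Cell ''key'' (Var ''u'')))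
         (Assign ''pos'' (Var ''v'') (Plus (Cell ''pos'' (Var ''v'')) (Const 1)))
         Skip) s3 s4"
      proof (rule exec_det_If)
        assume "aval (Minus (Cell ''key'' (Var ''v'')) (Cell ''key'' (Var ''u''))) s3 \<noteq> 0"
        then show "exec_det 1 (Assign ''pos'' (Var ''v'') (Plus (Cell ''pos'' (Var ''v'')) (Const 1))) s3 s4"
          using 3 exec_det_Assign [of "''pos''" "Var ''v''" "Plus (Cell ''pos'' (Var ''v'')) (Const 1)" s3]
          by (simp add: s4_def J_def F_def)
      next
        assume "aval (Minus (Cell ''key'' (Var ''v'')) (Cell ''key'' (Var ''u''))) s3 = 0"
        then show "exec_det 1 Skip s3 s4"
          using 3 exec_det_mono [OF exec_det_Skip, of 1] by (simp add: s4_def J_def F_def)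
      qed
      moreover have "s4 ''u'' 0 = l" "s4 ''n'' 0 = n"
        using 3 by (auto simp: s4_def update_apply)
      moreover have "J k (Suc l) (update s4 ''u'' 0 (Suc l))"
        using 3 by (auto simp: J_def F_def s4_def update_def p_def card_Collect_less_Suc)
      ultimately show "\<exists>s'. exec_det 2 (If (Minus (Cell ''key'' (Var ''v'')) (Cell ''key'' (Var ''u'')))
         (Assign ''pos'' (Var ''v'') (Plus (Cell ''pos'' (Var ''v'')) (Const 1)))
         Skip) s3 s' \<and> s' ''u'' 0 = l \<and> s' ''n'' 0 = n \<and> J k (Suc l) (update s' ''u'' 0 (Suc l))"
        by (intro exI [of _ s4]) (simp add: eval_nat_numeral)
    next
      show "J k 0 (update s1 ''u'' 0 0)"
        using 1 by (auto simp: J_def I_def F_def update_def p_def)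
    qed (use 1 in auto)
    then obtain s6 where s6: "exec_det (n * 7 + 4) (For ''u''
       (If (Minus (Cell ''key'' (Var ''v'')) (Cell ''key'' (Var ''u'')))
         (Assign ''pos'' (Var ''v'') (Plus (Cell ''pos'' (Var ''v'')) (Const 1)))
         Skip)) s1 s6" "s6 ''n'' 0 = n" "J k n s6"
      by auto
    have "I (Suc k) (update s6 ''v'' 0 (Suc k))"
      using s6 by (auto simp: I_def J_def F_def update_def less_Suc_eq)
    then show "\<exists>s'. exec_det (n * 7 + 4) (For ''u''
       (If (Minus (Cell ''key'' (Var ''v'')) (Cell ''key'' (Var ''u'')))
         (Assign ''pos'' (Var ''v'') (Plus (Cell ''pos'' (Var ''v'')) (Const 1)))
         Skip)) s1 s' \<and> s' ''v'' 0 = k \<and> s' ''n'' 0 = n \<and> I (Suc k) (update s' ''v'' 0 (Suc k))"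
      using s6 by (intro exI [of _ s6]) (auto simp: J_def)
  next
    show "I 0 (update s ''v'' 0 0)"
      using assms by (auto simp: I_def F_def update_def)
  qed (use assms in auto)
  then obtain s' where "exec_det (n * (n * 7 + 9) + 4) position_phase s s'" "I n s'"
    by (auto simp: add.assoc)
  then show ?thesis
    by (intro exI [of _ s']) (simp add: I_def F_def p_def)
qed

text \<open>The value \<open>pos u + 1 - i\<close> is nonzero exactly when
  \<open>i \<le> pos u\<close>. Rows from \<open>n\<close> on keep their initial zeros and describe
  the empty set.\<close>

lemma exec_output_phase:
  assumes "s ''n'' 0 = n" "s ''j'' 0 = 0" "s ''out'' = (\<lambda>_. 0)"
  shows "\<exists>s'. exec_det (n * (n * 8 + 9) + 4) output_phase s s' \<and>
     (\<forall>i u. u < n \<longrightarrow> s' ''out'' (i * n + u) = (if i < n then s ''pos'' u + 1 - i else 0))"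
proof -
  define F where "F = (\<lambda>s'. \<forall>y. y \<notin> {''v'', ''u'', ''j'', ''out''} \<longrightarrow> s' y = s y)"
  \<comment> \<open>The output is addressed linearly by \<open>''j''\<close>; \<open>div\<close> and
    \<open>mod\<close> recover the row and the vertex.\<close>
  define f where "f = (\<lambda>m. s ''pos'' (m mod n) + 1 - m div n)"
  define G where "G = (\<lambda>m s'. F s' \<and> s' ''j'' 0 = m \<and> (\<forall>i. s' ''out'' i = (if i < m then f i else 0)))"
  define I where "I = (\<lambda>k s'. G (k * n) s')"
  define J where "J = (\<lambda>k l s'. G (k * n + l) s' \<and> s' ''v'' 0 = k)"
  have "\<exists>s'. exec_det (n * (n * 8 + 4 + 5) + 4) output_phase s s' \<and> s' ''v'' 0 = n \<and> s' ''n'' 0 = n \<and> I n s'"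
    unfolding output_phase_def
  proof (rule exec_det_For)
    fix k s1 assume 1: "k < n" "I k s1" "s1 ''v'' 0 = k" "s1 ''n'' 0 = n"
    have "\<exists>s'. exec_det (n * (3 + 5) + 4) (For ''u'' (Seq
       (Assign ''out'' (Var ''j'') (Minus (Plus (Cell ''pos'' (Var ''u'')) (Const 1)) (Var ''v'')))
       (Assign ''j'' (Const 0) (Plus (Var ''j'') (Const 1))))) s1 s' \<and> s' ''u'' 0 = n \<and> s' ''n'' 0 = n \<and> J k n s'"
    proof (rule exec_det_For)
      fix l s3 assume 3: "l < n" "J k l s3" "s3 ''u'' 0 = l" "s3 ''n'' 0 = n"
      define s4 where "s4 = update s3 ''out'' (k * n + l) (s ''pos'' l + 1 - k)"
      define s5 where "s5 = update s4 ''j'' 0 (k * n + l + 1)"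
      have f: "f (k * n + l) = s ''pos'' l + 1 - k"
        using 3 by (simp add: f_def)
      have "exec_det 1 (Assign ''out'' (Var ''j'') (Minus (Plus (Cell ''pos'' (Var ''u'')) (Const 1)) (Var ''v''))) s3 s4"
        using 3 exec_det_Assign [of "''out''" "Var ''j''" "Minus (Plus (Cell ''pos'' (Var ''u'')) (Const 1)) (Var ''v'')" s3]
        by (simp add: s4_def J_def G_def F_def)
      moreover have "s4 ''j'' 0 = k * n + l"
        using 3 by (simp add: s4_def J_def G_def update_apply)
      then have "exec_det 1 (Assign ''j'' (Const 0) (Plus (Var ''j'') (Const 1))) s4 s5"
        using exec_det_Assign [of "''j''" "Const 0" "Plus (Var ''j'') (Const 1)" s4]
        by (simp add: s5_def)
      ultimately have "exec_det (1 + 1 + 1) (Seq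
       (Assign ''out'' (Var ''j'') (Minus (Plus (Cell ''pos'' (Var ''u'')) (Const 1)) (Var ''v'')))
       (Assign ''j'' (Const 0) (Plus (Var ''j'') (Const 1)))) s3 s5"
        by (rule exec_det_Seq)
      moreover have "s5 ''u'' 0 = l" "s5 ''n'' 0 = n"
        using 3 by (auto simp: s5_def s4_def update_apply)
      moreover have "J k (Suc l) (update s5 ''u'' 0 (Suc l))"
        using 3 f by (auto simp: J_def G_def F_def s5_def s4_def update_def less_Suc_eq)
      ultimately show "\<exists>s'. exec_det 3 (Seq
       (Assign ''out'' (Var ''j'') (Minus (Plus (Cell ''pos'' (Var ''u'')) (Const 1)) (Var ''v'')))
       (Assign ''j'' (Const 0) (Plus (Var ''j'') (Const 1)))) s3 s' \<and>
       s' ''u'' 0 = l \<and> s' ''n'' 0 = n \<and> J k (Suc l) (update s' ''u'' 0 (Suc l))"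
        by (intro exI [of _ s5]) (simp add: eval_nat_numeral)
    next
      show "J k 0 (update s1 ''u'' 0 0)"
        using 1 by (auto simp: J_def I_def G_def F_def update_def)
    qed (use 1 in auto)
    then obtain s6 where s6: "exec_det (n * 8 + 4) (For ''u'' (Seq
       (Assign ''out'' (Var ''j'') (Minus (Plus (Cell ''pos'' (Var ''u'')) (Const 1)) (Var ''v'')))
       (Assign ''j'' (Const 0) (Plus (Var ''j'') (Const 1))))) s1 s6" "s6 ''n'' 0 = n" "J k n s6"
      by auto
    have "I (Suc k) (update s6 ''v'' 0 (Suc k))"
      using s6 by (auto simp: I_def J_def G_def F_def update_def add.commute)
    then show "\<exists>s'. exec_det (n * 8 + 4) (For ''u'' (Seq
       (Assign ''out'' (Var ''j'') (Minus (Plus (Cell ''pos'' (Var ''u'')) (Const 1)) (Var ''v'')))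
       (Assign ''j'' (Const 0) (Plus (Var ''j'') (Const 1))))) s1 s' \<and>
       s' ''v'' 0 = k \<and> s' ''n'' 0 = n \<and> I (Suc k) (update s' ''v'' 0 (Suc k))"
      using s6 by (intro exI [of _ s6]) (auto simp: J_def)
  next
    show "I 0 (update s ''v'' 0 0)"
      using assms by (auto simp: I_def G_def F_def update_def)
  qed (use assms in auto)
  then obtain s' where s': "exec_det (n * (n * 8 + 9) + 4) output_phase s s'" "I n s'"
    by (auto simp: add.assoc)
  have "s' ''out'' (i * n + u) = (if i < n then s ''pos'' u + 1 - i else 0)" if "u < n" for i u
  proof -
    have "i * n + u < n * n \<longleftrightarrow> i < n"
      using that by (metis div_less_iff_less_mult div_mult_self3 add.commute div_less
          add_0 less_nat_zero_code not_gr_zero)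
    then show ?thesis
      using s'(2) that by (simp add: I_def G_def f_def)
  qed
  then show ?thesis using s'(1) by blast
qed

section \<open>The whole program and its success probability\<close>

definition sorting_phases :: com where
  "sorting_phases = Seq degree_phase (Seq key_phase (Seq position_phase output_phase))"

lemma exec_sorting_phases:
  assumes "X \<subseteq> {..<n}"
  shows "\<exists>s'. exec_det (24 * n * n + 36 * n + 19) sorting_phases (flipped 0 n (graph_input n E) X) s' \<and>
     (\<forall>i\<le>n. output_sets n s' i =
        {v \<in> {..<n}. i \<le> position {..<n} (degree_key {..<n} E id) (n * n + n) X v})"
proof -
  define s where "s = flipped 0 n (graph_input n E) X"
  have s: "s ''n'' 0 = n" "s ''i'' 0 = 0" "s ''j'' 0 = 0" "s ''adj'' = graph_input n E ''adj''"
    "s ''pos'' = (\<lambda>_. 0)" "s ''out'' = (\<lambda>_. 0)" "\<And>v. v < n \<Longrightarrow> s ''x'' v = of_bool (v \<in> X)"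
    by (auto simp: s_def flipped_def graph_input_def fun_eq_iff)
  obtain s1 where s1: "exec_det (n * (n * 9 + 11) + 4) degree_phase s s1"
    "\<forall>y. y \<notin> {''v'', ''u'', ''i'', ''key''} \<longrightarrow> s1 y = s y" "s1 ''i'' 0 = n * n"
    "\<forall>v<n. s1 ''key'' v = degree_key {..<n} E id v"
    using exec_degree_phase [of s n E] s by blast
  have n1: "s1 ''n'' 0 = n" using s1(2) s(1) by simp
  obtain s2 where s2: "exec_det (n * 7 + 4) key_phase s1 s2"
    "\<forall>y. y \<notin> {''v'', ''key''} \<longrightarrow> s2 y = s1 y"
    "\<forall>v<n. s2 ''key'' v = (if s1 ''x'' v \<noteq> 0 then s1 ''i'' 0 + n - s1 ''key'' v else s1 ''i'' 0 + n + s1 ''key'' v)"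
    using exec_key_phase [of s1 n] n1 by blast
  have n2: "s2 ''n'' 0 = n" "s2 ''pos'' = (\<lambda>_. 0)" using s2(2) s1(2) s(1,5) by simp_all
  have key: "s2 ''key'' v = key (degree_key {..<n} E id) (n * n + n) X v" if "v < n" for v
    using s2(3) s1(2-4) s(7) that by (simp add: degree_key_def key_def)
  obtain s3 where s3: "exec_det (n * (n * 7 + 9) + 4) position_phase s2 s3"
    "\<forall>y. y \<notin> {''v'', ''u'', ''pos''} \<longrightarrow> s3 y = s2 y"
    "\<forall>v<n. s3 ''pos'' v = card {u. u < n \<and> s2 ''key'' u < s2 ''key'' v}"
    using exec_position_phase [of s2 n] n2 by blast
  have n3: "s3 ''n'' 0 = n" "s3 ''j'' 0 = 0" "s3 ''out'' = (\<lambda>_. 0)"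
    using s3(2) s2(2) s1(2) s(1,3,6) by simp_all
  obtain s4 where s4: "exec_det (n * (n * 8 + 9) + 4) output_phase s3 s4"
    "\<forall>i u. u < n \<longrightarrow> s4 ''out'' (i * n + u) = (if i < n then s3 ''pos'' u + 1 - i else 0)"
    using exec_output_phase [of s3 n] n3 by blast
  have "exec_det (n * (n * 9 + 11) + 4 + 1 + (n * 7 + 4 + 1 + (n * (n * 7 + 9) + 4 + 1 + (n * (n * 8 + 9) + 4))))
      sorting_phases s s4"
    unfolding sorting_phases_def by (intro exec_det_Seq) (use s1 s2 s3 s4 in blast)+
  moreover have "n * (n * 9 + 11) + 4 + 1 + (n * 7 + 4 + 1 + (n * (n * 7 + 9) + 4 + 1 + (n * (n * 8 + 9) + 4)))
      = 24 * n * n + 36 * n + 19"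
    by (simp add: algebra_simps)
  ultimately have "exec_det (24 * n * n + 36 * n + 19) sorting_phases s s4"
    by (simp only:)
  moreover have "output_sets n s4 i =
      {v \<in> {..<n}. i \<le> position {..<n} (degree_key {..<n} E id) (n * n + n) X v}" if "i \<le> n" for i
  proof -
    have pos: "s3 ''pos'' v = position {..<n} (degree_key {..<n} E id) (n * n + n) X v" if "v < n" for v
      using s3(3) key that by (auto simp: position_def intro!: arg_cong [where f = card])
    \<comment> \<open>For \<open>i = n\<close> both sides are false, since positions are below
      \<open>n\<close>.\<close>
    then have "s4 ''out'' (i * n + v) \<noteq> 0 \<longleftrightarrow>
        i \<le> position {..<n} (degree_key {..<n} E id) (n * n + n) X v" if "v < n" for v
      using s4(2) \<open>i \<le> n\<close> that
        position_less_card [of "{..<n}" v "degree_key {..<n} E id" "n * n + n" X] by auto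
    then show ?thesis
      by (auto simp: output_sets_def)
  qed
  ultimately show ?thesis
    unfolding s_def by blast
qed

definition chain_program :: com where
  "chain_program = Seq flip_phase sorting_phases"

text \<open>\<open>h\<close> takes the outcome \<open>X\<close> of the coins to the final memory, so
  the result is the image of a uniform random subset.\<close>

lemma exec_chain_program:
  assumes graph: "fin_simple_graph {..<n} E"
  obtains h where
    "exec (24 * n * n + 42 * n + 22) chain_program (graph_input n E) (map_pmf h (pmf_of_set (Pow {..<n})))"
    "\<And>X. X \<in> Pow {..<n} \<Longrightarrow> degree_order.balanced {..<n} E (degree_key {..<n} E id) X \<Longrightarrow>
       low_cut_chain {..<n} E (output_sets n (h X))"
proof -
  define P where "P = (\<lambda>X s'. exec_det (24 * n * n + 36 * n + 19) sorting_phases (flipped 0 n (graph_input n E) X) s' \<and>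
     (\<forall>i\<le>n. output_sets n s' i =
        {v \<in> {..<n}. i \<le> position {..<n} (degree_key {..<n} E id) (n * n + n) X v}))"
  define h where "h = (\<lambda>X. SOME s'. P X s')"
  have h: "P X (h X)" if "X \<subseteq> {..<n}" for X
  proof -
    have "\<exists>s'. P X s'"
      unfolding P_def using that by (rule exec_sorting_phases)
    then show ?thesis
      unfolding h_def by (rule someI_ex)
  qed
  define s0 where "s0 = graph_input n E"
  define U where "U = pmf_of_set (Pow {..<n})"
  have set_U: "set_pmf U = Pow {..<n}"
    unfolding U_def by (rule set_pmf_of_set) auto
  have flip: "exec (6 * n + 2) flip_phase s0 (map_pmf (flipped 0 n s0) U)"
    using exec_flip_phase [of 0 n s0]
    by (simp add: s0_def graph_input_def U_def lessThan_atLeast0 mult.commute)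
  have X_flipped: "{v. v < n \<and> flipped 0 n s0 X ''x'' v \<noteq> 0} = X" if "X \<subseteq> {..<n}" for X
    using that by (auto simp: flipped_def)
  \<comment> \<open>The later phases receive only the memory, so \<open>X\<close> is read back from
    \<open>''x''\<close>.\<close>
  have "exec (6 * n + 2 + 1 + (24 * n * n + 36 * n + 19)) chain_program s0
      (bind_pmf (map_pmf (flipped 0 n s0) U) (\<lambda>s. return_pmf (h {v. v < n \<and> s ''x'' v \<noteq> 0})))"
    unfolding chain_program_def
  proof (rule exec_Seq [OF flip])
    fix s assume "s \<in> set_pmf (map_pmf (flipped 0 n s0) U)"
    then obtain X where "X \<subseteq> {..<n}" "s = flipped 0 n s0 X"
      by (auto simp: set_U)
    then show "exec (24 * n * n + 36 * n + 19) sorting_phases s (return_pmf (h {v. v < n \<and> s ''x'' v \<noteq> 0}))"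
      using h [of X] X_flipped [of X] by (simp add: P_def exec_det_def s0_def)
  qed
  also have "bind_pmf (map_pmf (flipped 0 n s0) U) (\<lambda>s. return_pmf (h {v. v < n \<and> s ''x'' v \<noteq> 0})) = map_pmf h U"
    unfolding bind_map_pmf map_pmf_def [of h]
    by (intro bind_pmf_cong refl) (use X_flipped set_U in auto)
  finally have "exec (24 * n * n + 42 * n + 22) chain_program s0 (map_pmf h U)"
    by (simp add: algebra_simps)
  moreover have "low_cut_chain {..<n} E (output_sets n (h X))"
    if "X \<in> Pow {..<n}" "degree_order.balanced {..<n} E (degree_key {..<n} E id) X" for X
  proof -
    interpret degree_order "{..<n}" E "degree_key {..<n} E id"
      using graph by (rule degree_order_degree_key) auto
    show ?thesis
      using degree_key_bounds [OF graph, of id] h [of X] that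
      by (intro low_cut_chain_position [of "n * n + n" X]) (auto simp: P_def)
  qed
  ultimately show ?thesis
    using that unfolding s0_def U_def by blast
qed

theorem theorem5p1:
  shows "(\<forall>(V :: 'a set) E. fin_simple_graph V E \<longrightarrow> (\<exists>S. low_cut_chain V E S)) \<and>
    rand_poly_time_solvable
      {(n, E). fin_simple_graph {..<n} E}
      (\<lambda>(n, E). n)
      (\<lambda>(n, E). graph_input n E)
      (\<lambda>(n, E) s. low_cut_chain {..<n} E (output_sets n s))"
proof (intro conjI allI impI)
  show "\<exists>S. low_cut_chain V E S" if "fin_simple_graph V E" for V :: "'a set" and E
    using that by (rule ex_low_cut_chain)
next
  \<comment> \<open>Coefficients of the running time, lowest degree first.\<close>
  define p :: "nat poly" where "p = [:22, 42, 24:]"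
  have "(\<forall>(c', s') \<in> set_pmf (run (poly p n) chain_program (graph_input n E)). c' = Skip) \<and>
      measure_pmf.prob (run (poly p n) chain_program (graph_input n E))
        {(c', s'). c' = Skip \<and> low_cut_chain {..<n} E (output_sets n s')} \<ge> 2 / 3"
    if graph: "fin_simple_graph {..<n} E" for n E
  proof -
    interpret degree_order "{..<n}" E "degree_key {..<n} E id"
      using graph by (rule degree_order_degree_key) auto
    define U where "U = pmf_of_set (Pow {..<n})"
    obtain h where h: "exec (24 * n * n + 42 * n + 22) chain_program (graph_input n E) (map_pmf h U)"
      "\<And>X. X \<in> Pow {..<n} \<Longrightarrow> balanced X \<Longrightarrow> low_cut_chain {..<n} E (output_sets n (h X))"
      using exec_chain_program [OF graph] unfolding U_def by blast
    have "poly p n = 24 * n * n + 42 * n + 22"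
      by (simp add: p_def algebra_simps)
    then have run: "run (poly p n) chain_program (graph_input n E) = map_pmf (Pair Skip) (map_pmf h U)"
      using h(1) by (simp add: exec_def)
    have "2 / 3 \<le> 1 - measure_pmf.prob U {X. \<not> balanced X}"
    proof -
      have "measure_pmf.prob U {X. \<not> balanced X} = card (Pow {..<n} \<inter> {X. \<not> balanced X}) / card (Pow {..<n})"
        unfolding U_def by (rule measure_pmf_of_set) auto
      also have "Pow {..<n} \<inter> {X. \<not> balanced X} = {X \<in> Pow {..<n}. \<not> balanced X}"
        by auto
      also have "real (card {X \<in> Pow {..<n}. \<not> balanced X}) / real (card (Pow {..<n})) \<le> 1 / 3"
        using card_unbalanced by (simp add: card_Pow field_simps)
      finally show ?thesis by linarith
    qed
    also have "\<dots> = measure_pmf.prob U (- {X. \<not> balanced X})"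
      using measure_pmf.prob_compl [of "{X. \<not> balanced X}" U]
      by (simp only: space_measure_pmf Compl_eq_Diff_UNIV sets_measure_pmf UNIV_I)
    also have "\<dots> \<le> measure_pmf.prob U {X. low_cut_chain {..<n} E (output_sets n (h X))}"
    \<comment> \<open>The inclusion holds only almost surely, as \<open>h\<close> is controlled only
      on subsets of \<open>{..<n}\<close>.\<close>
    proof (rule measure_pmf.finite_measure_mono_AE)
      have "set_pmf U = Pow {..<n}"
        unfolding U_def by (rule set_pmf_of_set) auto
      then show "AE X in measure_pmf U. X \<in> - {X. \<not> balanced X} \<longrightarrow>
          X \<in> {X. low_cut_chain {..<n} E (output_sets n (h X))}"
        using h(2) by (auto simp: AE_measure_pmf_iff)
    qed simp
    finally show ?thesis
      by (auto simp: run vimage_def)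
  qed
  then show "rand_poly_time_solvable
      {(n, E). fin_simple_graph {..<n} E}
      (\<lambda>(n, E). n)
      (\<lambda>(n, E). graph_input n E)
      (\<lambda>(n, E) s. low_cut_chain {..<n} E (output_sets n s))"
    unfolding rand_poly_time_solvable_def
    by (intro exI [of _ chain_program] exI [of _ p]) auto
qed

end
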